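(* Every square-integrable real-valued stochastic process $x_t$ with continuous two-point function $\langle x(t)x(s)\rangle$ admits a neural network representation, generically one with a countably infinite set of parameters, namely $x_t=\phi_\theta(t)$ with the architecture $$\phi_\theta(t)=\langle x(t)\rangle+\sum_{k=1}^{\infty}\theta^k e_k(t),$$ where the parameters $\theta^k$ (pairwise uncorrelated, but not necessarily independent, random variables) and the functions $e_k$ (continuous, orthogonal, real-valued) are those of the Kosambi-Karhunen-Loève decomposition $\hat{x}_t=\sum_{k=1}^{\infty}\theta^k e_k(t)$ of the zero-mean process $\hat{x}_t=x_t-\langle x(t)\rangle$. Consequently, every minimal quantum mechanical model (MQM) is a neural network quantum mechanics (NN-QM), and the space of NN-QMs precisely coincides with the space of MQMs.
   Context: $\langle\cdot\rangle$ denotes expectation. A stochastic process is a collection of real-valued random variables $\{x(t)\mid t\in T\}$, also written $x_t$, specified by the joint probability distributions of $x(t_1),\ldots,x(t_n)$ for all finite collections of times; the index set $T$ is typically $\mathbb{R}$ or a finite interval $[a,b]$. Square-integrability means that the two-point function $G^{(2)}(t,s)=\langle x(t)x(s)\rangle$ is finite for all $t,s$. A minimal quantum mechanical model (MQM) is an assignment, for any $n\in\mathbb{N}$ and to every collection of times $t_1,\ldots,t_n$, of a joint probability distribution for random variables $x(t_1),\ldots,x(t_n)$ (that is, a stochastic process) such that: (P1) mean-square continuity holds, $\lim_{t\to s}\langle|x(t)-x(s)|^2\rangle=0$ for all $s$ (which implies that $G^{(2)}$ is continuous); and (P2) $G^{(2)}(t,s)$ is finite for all $t,s$. A neural network is a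 parameterized family of functions $\phi_\theta:\mathbb{R}\to\mathbb{R}$ (the architecture) determined by a set of parameters $\theta$, possibly infinitely many, which are random variables with a joint probability distribution $P(\theta)$. A stochastic process admits a neural network representation if $x_t=\phi_\theta(t)$ for some architecture and parameter density $P(\theta)$. A neural network quantum mechanics (NN-QM) is an MQM that can be represented as a neural network, i.e. a stochastic process with a neural network representation that satisfies (P1) and (P2). The Kosambi-Karhunen-Loève theorem states: a square-integrable stochastic process $x_t$ on an interval $[a,b]$ with $\langle x(t)\rangle=0$ for all $t\in[a,b]$ and with continuous two-point function admits a decomposition $x_t=\sum_{k=1}^{\infty}\theta^k e_k(t)$, where the $e_k$ are continuous, orthogonal real-valued functions on $[a,b]$ and the $\theta^k$ are pairwise uncorrelated (but not necessarily independent) random variables. Random variables $X,Y$ are uncorrelated if $\langle XY\rangle=\langle X\rangle\langle Y\rangle$. *)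

theory Defs
  imports "HOL-Probability.Probability"
begin

section \<open>Processes on a probability space\<close>

definition two_point :: "'w measure \<Rightarrow> (real \<Rightarrow> 'w \<Rightarrow> real) \<Rightarrow> real \<Rightarrow> real \<Rightarrow> real" where
  "two_point M x t s = (\<integral>\<omega>. x t \<omega> * x s \<omega> \<partial>M)"

text \<open>Finiteness of the two-point function is integrability of the products; the Bochner integral
  alone would silently return 0 for a non-integrable product.\<close>

definition square_integrable_process ::
    "real set \<Rightarrow> 'w measure \<Rightarrow> (real \<Rightarrow> 'w \<Rightarrow> real) \<Rightarrow> bool" where
  "square_integrable_process T M x \<longleftrightarrow>
     prob_space M \<and>
     (\<forall>t\<in>T. x t \<in> borel_measurable M) \<and>
     (\<forall>t\<in>T. \<forall>s\<in>T. integrable M (\<lambda>\<omega>. x t \<omega> * x s \<omega>))"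

definition mean_fun :: "'w measure \<Rightarrow> (real \<Rightarrow> 'w \<Rightarrow> real) \<Rightarrow> real \<Rightarrow> real" where
  "mean_fun M x t = (\<integral>\<omega>. x t \<omega> \<partial>M)"

definition centered :: "'w measure \<Rightarrow> (real \<Rightarrow> 'w \<Rightarrow> real) \<Rightarrow> real \<Rightarrow> 'w \<Rightarrow> real" where
  "centered M x t \<omega> = x t \<omega> - mean_fun M x t"

definition mean_square_dist :: "'w measure \<Rightarrow> ('w \<Rightarrow> real) \<Rightarrow> ('w \<Rightarrow> real) \<Rightarrow> ennreal" where
  "mean_square_dist M X Y = (\<integral>\<^sup>+\<omega>. ennreal ((X \<omega> - Y \<omega>)\<^sup>2) \<partial>M)"

definition joint_law :: "'w measure \<Rightarrow> (real \<Rightarrow> 'w \<Rightarrow> real) \<Rightarrow> real set \<Rightarrow> (real \<Rightarrow> real) measure" where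
  "joint_law M x J = distr M (\<Pi>\<^sub>M t\<in>J. borel) (\<lambda>\<omega>. \<lambda>t\<in>J. x t \<omega>)"

section \<open>Neural networks\<close>

text \<open>Parameters are indexed by a set \<open>I\<close> of arbitrary cardinality; \<open>Q\<close> is their joint
  law on the product space, and need not have a density. A network is itself a stochastic process,
  with sample space \<open>Q\<close>.\<close>

definition neural_network ::
    "real set \<Rightarrow> 'i set \<Rightarrow> ('i \<Rightarrow> real) measure \<Rightarrow> (('i \<Rightarrow> real) \<Rightarrow> real \<Rightarrow> real) \<Rightarrow> bool" where
  "neural_network T I Q \<phi> \<longleftrightarrow>
     prob_space Q \<and>
     sets Q = sets (\<Pi>\<^sub>M i\<in>I. borel) \<and>
     (\<forall>t\<in>T. (\<lambda>p. \<phi> p t) \<in> borel_measurable Q)"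

definition param_law :: "'w measure \<Rightarrow> 'i set \<Rightarrow> ('i \<Rightarrow> 'w \<Rightarrow> real) \<Rightarrow> ('i \<Rightarrow> real) measure" where
  "param_law M I \<theta> = distr M (\<Pi>\<^sub>M i\<in>I. borel) (\<lambda>\<omega>. \<lambda>i\<in>I. \<theta> i \<omega>)"

text \<open>The equation \<open>x\<^sub>t = \<phi>\<^sub>\<theta>(t)\<close> between random variables on one probability
  space, for each time almost surely.\<close>

definition nn_represents ::
    "real set \<Rightarrow> 'w measure \<Rightarrow> (real \<Rightarrow> 'w \<Rightarrow> real) \<Rightarrow>
     'i set \<Rightarrow> ('i \<Rightarrow> 'w \<Rightarrow> real) \<Rightarrow> (('i \<Rightarrow> real) \<Rightarrow> real \<Rightarrow> real) \<Rightarrow> bool" where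
  "nn_represents T M x I \<theta> \<phi> \<longleftrightarrow>
     (\<forall>i\<in>I. \<theta> i \<in> borel_measurable M) \<and>
     neural_network T I (param_law M I \<theta>) \<phi> \<and>
     (\<forall>t\<in>T. AE \<omega> in M. x t \<omega> = \<phi> (\<lambda>i\<in>I. \<theta> i \<omega>) t)"

section \<open>The Kosambi-Karhunen-Loeve decomposition and its architecture\<close>

definition uncorrelated :: "'w measure \<Rightarrow> ('w \<Rightarrow> real) \<Rightarrow> ('w \<Rightarrow> real) \<Rightarrow> bool" where
  "uncorrelated M X Y \<longleftrightarrow>
     integrable M X \<and> integrable M Y \<and> integrable M (\<lambda>\<omega>. X \<omega> * Y \<omega>) \<and>
     (\<integral>\<omega>. X \<omega> * Y \<omega> \<partial>M) = (\<integral>\<omega>. X \<omega> \<partial>M) * (\<integral>\<omega>. Y \<omega> \<partial>M)"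

text \<open>The series converges in mean square, as usual for this decomposition; it need not
  converge almost surely. A decomposition with finitely many terms is padded with zeros.\<close>

definition kkl_decomposition ::
    "real \<Rightarrow> real \<Rightarrow> 'w measure \<Rightarrow> (real \<Rightarrow> 'w \<Rightarrow> real) \<Rightarrow>
     (nat \<Rightarrow> 'w \<Rightarrow> real) \<Rightarrow> (nat \<Rightarrow> real \<Rightarrow> real) \<Rightarrow> bool" where
  "kkl_decomposition a b M y \<theta> e \<longleftrightarrow>
     (\<forall>k. continuous_on {a..b} (e k)) \<and>
     (\<forall>j k. j \<noteq> k \<longrightarrow> integral {a..b} (\<lambda>t. e j t * e k t) = 0) \<and>
     (\<forall>k. \<theta> k \<in> borel_measurable M \<and> integrable M (\<lambda>\<omega>. (\<theta> k \<omega>)\<^sup>2)) \<and>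
     (\<forall>j k. j \<noteq> k \<longrightarrow> uncorrelated M (\<theta> j) (\<theta> k)) \<and>
     (\<forall>t\<in>{a..b}. (\<lambda>n. mean_square_dist M (\<lambda>\<omega>. \<Sum>k<n. \<theta> k \<omega> * e k t) (y t)) \<longlonglongrightarrow> 0)"

text \<open>\<open>\<phi>\<^sub>\<theta>(t) = m(t) + (\<Sum>k. \<theta>\<^sup>k e\<^sub>k(t))\<close> as a function of the parameter
  sequence: the actual sum at every sequence for which the series converges, and the limit in mean
  square of the partial sums under the parameter law \<open>Q\<close>.\<close>

definition series_architecture ::
    "real set \<Rightarrow> (nat \<Rightarrow> real) measure \<Rightarrow> (real \<Rightarrow> real) \<Rightarrow> (nat \<Rightarrow> real \<Rightarrow> real) \<Rightarrow>
     ((nat \<Rightarrow> real) \<Rightarrow> real \<Rightarrow> real) \<Rightarrow> bool" where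
  "series_architecture S Q m e \<phi> \<longleftrightarrow>
     (\<forall>t\<in>S. \<forall>p. summable (\<lambda>k. p k * e k t) \<longrightarrow> \<phi> p t = m t + (\<Sum>k. p k * e k t)) \<and>
     (\<forall>t\<in>S. (\<lambda>n. mean_square_dist Q (\<lambda>p. m t + (\<Sum>k<n. p k * e k t)) (\<lambda>p. \<phi> p t)) \<longlonglongrightarrow> 0)"

text \<open>The parameters that really enter the network: a parameter that is almost surely constant, or
  multiplies the zero function, does not count. There are infinitely many except
  in the non-generic case of a process of finite rank.\<close>

definition active_params ::
    "real set \<Rightarrow> 'w measure \<Rightarrow> (nat \<Rightarrow> 'w \<Rightarrow> real) \<Rightarrow> (nat \<Rightarrow> real \<Rightarrow> real) \<Rightarrow> nat set" where
  "active_params S M \<theta> e =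
     {k. (\<exists>t\<in>S. e k t \<noteq> 0) \<and> \<not> (\<exists>c. AE \<omega> in M. \<theta> k \<omega> = c)}"

definition finite_rank_process :: "real set \<Rightarrow> 'w measure \<Rightarrow> (real \<Rightarrow> 'w \<Rightarrow> real) \<Rightarrow> bool" where
  "finite_rank_process S M y \<longleftrightarrow>
     (\<exists>(n::nat) \<xi> f. (\<forall>i<n. \<xi> i \<in> borel_measurable M) \<and>
        (\<forall>t\<in>S. AE \<omega> in M. y t \<omega> = (\<Sum>i<n. \<xi> i \<omega> * f i t)))"

section \<open>Minimal quantum mechanical models\<close>

text \<open>An assignment \<open>P\<close> of a joint law to every finite set of times is a stochastic process if
  it is consistent. Two assignments are the same process if they agree on the finite subsets of
  \<open>T\<close>; the values of \<open>P\<close> elsewhere are irrelevant to all predicates below.\<close>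

definition stochastic_process :: "real set \<Rightarrow> (real set \<Rightarrow> (real \<Rightarrow> real) measure) \<Rightarrow> bool" where
  "stochastic_process T P \<longleftrightarrow> projective_family T P (\<lambda>_. borel)"

definition P1 :: "real set \<Rightarrow> (real set \<Rightarrow> (real \<Rightarrow> real) measure) \<Rightarrow> bool" where
  "P1 T P \<longleftrightarrow>
     (\<forall>s\<in>T. ((\<lambda>t. mean_square_dist (P {t, s}) (\<lambda>p. p t) (\<lambda>p. p s)) \<longlongrightarrow> 0) (at s within T))"

definition P2 :: "real set \<Rightarrow> (real set \<Rightarrow> (real \<Rightarrow> real) measure) \<Rightarrow> bool" where
  "P2 T P \<longleftrightarrow> (\<forall>t\<in>T. \<forall>s\<in>T. integrable (P {t, s}) (\<lambda>p. p t * p s))"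

definition MQM :: "real set \<Rightarrow> (real set \<Rightarrow> (real \<Rightarrow> real) measure) set" where
  "MQM T = {P. stochastic_process T P \<and> P1 T P \<and> P2 T P}"

text \<open>The type argument only supplies indices for the parameters.\<close>

definition admits_nn ::
    "'i itself \<Rightarrow> real set \<Rightarrow> (real set \<Rightarrow> (real \<Rightarrow> real) measure) \<Rightarrow> bool" where
  "admits_nn _ T P \<longleftrightarrow>
     (\<exists>(I :: 'i set) Q \<phi>. neural_network T I Q \<phi> \<and>
        (\<forall>J. finite J \<and> J \<subseteq> T \<longrightarrow> P J = joint_law Q (\<lambda>t p. \<phi> p t) J))"

definition NNQM :: "'i itself \<Rightarrow> real set \<Rightarrow> (real set \<Rightarrow> (real \<Rightarrow> real) measure) set" where
  "NNQM i T = {P. stochastic_process T P \<and> admits_nn i T P \<and> P1 T P \<and> P2 T P}"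

end

theory Submission
  imports Defs "HOL-Complex_Analysis.Great_Picard"
begin

text \<open>A singular value decomposition yields the Kosambi-Karhunen-Loeve expansion of a centered process
  \<open>y\<close> on \<open>[a, b]\<close> without integral operators or stochastic integrals. Map \<open>\<xi> \<in> L\<^sup>2\<close> to the
  continuous function \<open>\<xi>\<^sup>*(t) = \<langle>\<xi> y\<^sub>t\<rangle>\<close> and let \<open>\<xi>\<^sub>n\<close> maximise \<open>\<integral> \<xi>\<^sup>*(t)\<^sup>2 dt\<close> over the
  unit ball of the orthogonal complement of \<open>1, \<xi>\<^sub>0, \<dots>, \<xi>\<^sub>n\<^sub>-\<^sub>1\<close>. The first-order condition for the
  maximum makes the functions \<open>e\<^sub>n = \<xi>\<^sub>n\<^sup>*\<close> orthogonal. By Bessel's inequality the maxima are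
  summable, hence tend to 0, so the limit \<open>r\<close> of the residuals
  \<open>y\<^sub>t - (\<Sum>k<n. \<xi>\<^sub>k e\<^sub>k(t))\<close> satisfies \<open>r\<^sup>* = 0\<close> and is therefore orthogonal to
  \<open>y\<^sub>t\<close> and to all \<open>\<xi>\<^sub>k\<close>, that is, to itself.

  Mean-square limits are almost sure limits along a subsequence depending on \<open>t\<close> only. This makes
  the network a measurable function of its parameters: for the series these are the \<open>\<theta>\<^sup>k\<close>, and on
  all of \<open>T\<close> the values of the process at a countable dense set of times. An MQM is first realised
  on the path space by Kolmogorov's extension theorem.\<close>

section \<open>Square-integrable random variables\<close>

text \<open>Functions, not classes modulo null sets: \<open>ip\<close> is only positive semidefinite
  here, and norm 0 gives an identity almost surely (\<open>ip_self_zero_AE\<close>).\<close>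

definition L2 :: "'w measure \<Rightarrow> ('w \<Rightarrow> real) set" where
  "L2 M = {f \<in> borel_measurable M. integrable M (\<lambda>\<omega>. (f \<omega>)\<^sup>2)}"

definition ip :: "'w measure \<Rightarrow> ('w \<Rightarrow> real) \<Rightarrow> ('w \<Rightarrow> real) \<Rightarrow> real" where
  "ip M f g = (\<integral>\<omega>. f \<omega> * g \<omega> \<partial>M)"

text \<open>Real-valued partner of \<open>mean_square_dist\<close>, suited to algebra. The two agree
  as soon as the difference is in \<open>L2 M\<close>; otherwise the Bochner integral defaults to
  0.\<close>

definition sqdist :: "'w measure \<Rightarrow> ('w \<Rightarrow> real) \<Rightarrow> ('w \<Rightarrow> real) \<Rightarrow> real" where
  "sqdist M f g = (\<integral>\<omega>. (f \<omega> - g \<omega>)\<^sup>2 \<partial>M)"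

text \<open>Used in three ways: Cauchy-Schwarz for \<open>ip\<close>, Cauchy-Schwarz for
  \<open>energy\<close>, and, with \<open>A = 0\<close>, the first-order condition at a maximum,
  since then \<open>B\<close> must vanish.\<close>

lemma quadratic_nonneg_imp_discriminant:
  fixes A B C :: real
  assumes "\<And>s. 0 \<le> A + 2 * s * B + s\<^sup>2 * C"
  shows "B\<^sup>2 \<le> A * C"
proof (cases "C = 0")
  case True
  have "B = 0"
  proof (rule ccontr)
    assume "B \<noteq> 0"
    \<comment> \<open>For \<open>C = 0\<close> the expression is affine in \<open>s\<close>; this is
      the point where it equals -1.\<close>
    then have "A + 2 * (-(A + 1) / (2 * B)) * B + (-(A + 1) / (2 * B))\<^sup>2 * C = -1"
      using True by (simp add: field_simps)
    then show False using assms[of "-(A + 1) / (2 * B)"] by linarith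
  qed
  with True show ?thesis by simp
next
  case False
  have "C > 0"
  proof (rule ccontr)
    assume "\<not> C > 0"
    with False have C: "C < 0" by simp
    \<comment> \<open>So large that \<open>2 * B + s * C\<close> is at most
      \<open>- \<bar>A\<bar> - 1\<close>; the final \<open>+ 1\<close> ensures
      \<open>s \<ge> 1\<close>, so multiplying by \<open>s\<close> keeps the total negative.\<close>
    define s where "s = (\<bar>A\<bar> + 2 * \<bar>B\<bar> + 1) / (- C) + 1"
    have s1: "s \<ge> 1" using C by (simp add: s_def divide_nonneg_neg)
    have sC: "s * C = - (\<bar>A\<bar> + 2 * \<bar>B\<bar> + 1) + C"
      using C by (simp add: s_def field_simps)
    have "A + 2 * s * B + s\<^sup>2 * C = A + s * (2 * B + s * C)"
      by (simp add: power2_eq_square algebra_simps)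
    also have "\<dots> \<le> A + s * (- \<bar>A\<bar> - 1)"
      using s1 C unfolding sC by (intro add_left_mono mult_left_mono) auto
    also have "\<dots> \<le> A + 1 * (- \<bar>A\<bar> - 1)"
      using s1 by (intro add_left_mono mult_right_mono_neg) auto
    also have "\<dots> < 0" by simp
    finally show False using assms[of s] by simp
  qed
  \<comment> \<open>The vertex of the parabola, where the assumption is sharpest.\<close>
  have "0 \<le> A + 2 * (- B / C) * B + (- B / C)\<^sup>2 * C" by (rule assms)
  also have "\<dots> = A - B\<^sup>2 / C" using \<open>C > 0\<close> by (simp add: field_simps power2_eq_square)
  finally show ?thesis using \<open>C > 0\<close> by (simp add: field_simps)
qed

section \<open>Linear structure and inner product\<close>

lemma L2_measurable [measurable_dest]: "f \<in> L2 M \<Longrightarrow> f \<in> borel_measurable M"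
  by (simp add: L2_def)

lemma L2_integrable_mult:
  assumes "f \<in> L2 M" "g \<in> L2 M" shows "integrable M (\<lambda>\<omega>. f \<omega> * g \<omega>)"
proof (rule Bochner_Integration.integrable_bound)
  show "integrable M (\<lambda>\<omega>. (f \<omega>)\<^sup>2 + (g \<omega>)\<^sup>2)" using assms by (simp add: L2_def)
  show "(\<lambda>\<omega>. f \<omega> * g \<omega>) \<in> borel_measurable M" using assms by (auto simp add: L2_def)
  have "\<bar>u * v\<bar> \<le> u\<^sup>2 + v\<^sup>2" for u v :: real
    using sum_squares_bound[of "\<bar>u\<bar>" "\<bar>v\<bar>"] mult_nonneg_nonneg[of "\<bar>u\<bar>" "\<bar>v\<bar>"]
    unfolding abs_mult power2_abs by linarith
  then show "AE \<omega> in M. norm (f \<omega> * g \<omega>) \<le> norm ((f \<omega>)\<^sup>2 + (g \<omega>)\<^sup>2)" by simp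
qed

lemma L2_add: assumes "f \<in> L2 M" "g \<in> L2 M" shows "(\<lambda>\<omega>. f \<omega> + g \<omega>) \<in> L2 M"
proof -
  have "integrable M (\<lambda>\<omega>. (f \<omega>)\<^sup>2 + 2 * (f \<omega> * g \<omega>) + (g \<omega>)\<^sup>2)"
    using assms L2_integrable_mult[OF assms] by (simp add: L2_def)
  then show ?thesis using assms by (auto simp add: L2_def power2_sum algebra_simps)
qed

lemma L2_scale: assumes "f \<in> L2 M" shows "(\<lambda>\<omega>. c * f \<omega>) \<in> L2 M"
proof -
  have "(\<lambda>\<omega>. c * f \<omega>) \<in> borel_measurable M"
    using L2_measurable[OF assms] by (intro borel_measurable_times borel_measurable_const)
  moreover have "integrable M (\<lambda>\<omega>. (c * f \<omega>)\<^sup>2)"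
    using assms by (simp add: L2_def power_mult_distrib)
  ultimately show ?thesis unfolding L2_def by blast
qed

lemma L2_scale_right: "f \<in> L2 M \<Longrightarrow> (\<lambda>\<omega>. f \<omega> * c) \<in> L2 M"
  using L2_scale[of f M c] by (simp add: mult.commute)

lemma L2_diff: "f \<in> L2 M \<Longrightarrow> g \<in> L2 M \<Longrightarrow> (\<lambda>\<omega>. f \<omega> - g \<omega>) \<in> L2 M"
  using L2_add[of f M "\<lambda>\<omega>. -1 * g \<omega>"] L2_scale[of g M "-1"] by simp

lemma L2_zero: "(\<lambda>\<omega>. 0) \<in> L2 M"
  by (simp add: L2_def)

lemma L2_sum: "(\<And>i. i \<in> A \<Longrightarrow> f i \<in> L2 M) \<Longrightarrow> (\<lambda>\<omega>. \<Sum>i\<in>A. f i \<omega>) \<in> L2 M"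
proof (induction A rule: infinite_finite_induct)
  case (insert x F)
  then show ?case using L2_add[of "f x" M "\<lambda>\<omega>. \<Sum>i\<in>F. f i \<omega>"] by simp
qed (simp_all add: L2_zero)

lemma ip_commute: "ip M f g = ip M g f"
  by (simp add: ip_def mult.commute)

lemma ip_self_nonneg: "0 \<le> ip M f f"
  by (simp add: ip_def)

lemma sqdist_nonneg: "0 \<le> sqdist M f g"
  by (simp add: sqdist_def)

lemma sqdist_commute: "sqdist M f g = sqdist M g f"
  by (simp add: sqdist_def power2_commute)

lemma ip_add_left: "f \<in> L2 M \<Longrightarrow> g \<in> L2 M \<Longrightarrow> h \<in> L2 M \<Longrightarrow>
    ip M (\<lambda>\<omega>. f \<omega> + g \<omega>) h = ip M f h + ip M g h"
  by (simp add: ip_def distrib_right L2_integrable_mult)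

lemma ip_diff_left: "f \<in> L2 M \<Longrightarrow> g \<in> L2 M \<Longrightarrow> h \<in> L2 M \<Longrightarrow>
    ip M (\<lambda>\<omega>. f \<omega> - g \<omega>) h = ip M f h - ip M g h"
  by (simp add: ip_def left_diff_distrib L2_integrable_mult)

lemma ip_diff_right: "f \<in> L2 M \<Longrightarrow> g \<in> L2 M \<Longrightarrow> h \<in> L2 M \<Longrightarrow>
    ip M h (\<lambda>\<omega>. f \<omega> - g \<omega>) = ip M h f - ip M h g"
  by (simp add: ip_commute[of M h] ip_diff_left)

lemma ip_scale_left: "ip M (\<lambda>\<omega>. c * f \<omega>) h = c * ip M f h"
  by (simp add: ip_def mult.assoc)

lemma ip_sum_left:
  assumes "\<And>i. i \<in> A \<Longrightarrow> f i \<in> L2 M" "h \<in> L2 M"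
  shows "ip M (\<lambda>\<omega>. \<Sum>i\<in>A. f i \<omega>) h = (\<Sum>i\<in>A. ip M (f i) h)"
  unfolding ip_def sum_distrib_right
  by (rule Bochner_Integration.integral_sum) (use assms L2_integrable_mult in blast)

lemma sqdist_eq_ip: "sqdist M f g = ip M (\<lambda>\<omega>. f \<omega> - g \<omega>) (\<lambda>\<omega>. f \<omega> - g \<omega>)"
  by (simp add: sqdist_def ip_def power2_eq_square)

text \<open>Cauchy-Schwarz (any \<open>s\<close>), \<open>sqdist_expand\<close>
  (\<open>s = -1\<close>) and the parallelogram law (\<open>s = 1\<close>) are all read off this
  expansion.\<close>

lemma ip_add_scaled_self:
  assumes "f \<in> L2 M" "g \<in> L2 M"
  shows "ip M (\<lambda>\<omega>. f \<omega> + s * g \<omega>) (\<lambda>\<omega>. f \<omega> + s * g \<omega>)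
    = ip M f f + 2 * s * ip M f g + s\<^sup>2 * ip M g g"
proof -
  have g: "(\<lambda>\<omega>. s * g \<omega>) \<in> L2 M" by (rule L2_scale[OF assms(2)])
  note fg = L2_add[OF assms(1) g]
  have "ip M (\<lambda>\<omega>. f \<omega> + s * g \<omega>) (\<lambda>\<omega>. f \<omega> + s * g \<omega>)
    = ip M (\<lambda>\<omega>. f \<omega> + s * g \<omega>) f + s * ip M (\<lambda>\<omega>. f \<omega> + s * g \<omega>) g"
    by (simp add: ip_add_left[OF assms(1) g fg] ip_scale_left ip_commute[of M _ "\<lambda>\<omega>. f \<omega> + s * g \<omega>"])
  also have "\<dots> = (ip M f f + s * ip M g f) + s * (ip M f g + s * ip M g g)"
    by (simp add: ip_add_left[OF assms(1) g] assms ip_scale_left)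
  finally show ?thesis by (simp add: ip_commute[of M g f] algebra_simps power2_eq_square)
qed

lemma sqdist_expand:
  assumes "f \<in> L2 M" "g \<in> L2 M"
  shows "sqdist M f g = ip M f f - 2 * ip M f g + ip M g g"
  using ip_add_scaled_self[OF assms, of "-1"] by (simp add: sqdist_eq_ip)

lemma ip_Cauchy_Schwarz:
  assumes "f \<in> L2 M" "g \<in> L2 M"
  shows "(ip M f g)\<^sup>2 \<le> ip M f f * ip M g g"
proof (rule quadratic_nonneg_imp_discriminant)
  fix s show "0 \<le> ip M f f + 2 * s * ip M f g + s\<^sup>2 * ip M g g"
    unfolding ip_add_scaled_self[OF assms, of s, symmetric] by (rule ip_self_nonneg)
qed

lemma ip_self_zero_AE:
  assumes "f \<in> L2 M" "ip M f f = 0" shows "AE \<omega> in M. f \<omega> = 0"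
proof -
  have "integrable M (\<lambda>\<omega>. f \<omega> * f \<omega>)" by (rule L2_integrable_mult[OF assms(1) assms(1)])
  then have "AE \<omega> in M. f \<omega> * f \<omega> = 0"
    using integral_nonneg_eq_0_iff_AE[of M "\<lambda>\<omega>. f \<omega> * f \<omega>"] assms(2) by (simp add: ip_def)
  then show ?thesis by simp
qed

lemma ip_cong_AE:
  assumes "AE \<omega> in M. f \<omega> = f' \<omega>" "f \<in> borel_measurable M" "f' \<in> borel_measurable M" "h \<in> borel_measurable M"
  shows "ip M f h = ip M f' h"
  unfolding ip_def by (rule integral_cong_AE) (use assms in auto)

section \<open>Limits in mean square\<close>

lemma tendsto_zero_of_square:
  fixes f :: "'a \<Rightarrow> real"
  assumes "\<forall>\<^sub>F i in F. (f i)\<^sup>2 \<le> g i" "(g \<longlongrightarrow> 0) F"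
  shows "(f \<longlongrightarrow> 0) F"
proof -
  have "((\<lambda>i. (f i)\<^sup>2) \<longlongrightarrow> 0) F"
    by (rule tendsto_sandwich[OF _ assms(1) tendsto_const assms(2)]) simp
  then have "((\<lambda>i. sqrt ((f i)\<^sup>2)) \<longlongrightarrow> 0) F" using tendsto_real_sqrt by fastforce
  then show ?thesis by (simp add: tendsto_rabs_zero_iff)
qed

text \<open>By Cauchy-Schwarz applied to \<open>f i - f0\<close>. The general filter covers both
  partial sums and times tending to \<open>t\<close> within an interval; in the second case
  membership in \<open>L2 M\<close> is known only eventually.\<close>

lemma ip_tendsto:
  assumes "\<forall>\<^sub>F i in F. f i \<in> L2 M" "f0 \<in> L2 M" "g \<in> L2 M" "((\<lambda>i. sqdist M (f i) f0) \<longlongrightarrow> 0) F"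
  shows "((\<lambda>i. ip M (f i) g) \<longlongrightarrow> ip M f0 g) F"
proof -
  have "((\<lambda>i. ip M (f i) g - ip M f0 g) \<longlongrightarrow> 0) F"
  proof (rule tendsto_zero_of_square)
    show "\<forall>\<^sub>F i in F. (ip M (f i) g - ip M f0 g)\<^sup>2 \<le> sqdist M (f i) f0 * ip M g g"
      using assms(1)
    proof eventually_elim
      case (elim i)
      then show ?case
        using ip_Cauchy_Schwarz[OF L2_diff[OF elim assms(2)] assms(3)]
        by (simp add: sqdist_eq_ip ip_diff_left assms)
    qed
    show "((\<lambda>i. sqdist M (f i) f0 * ip M g g) \<longlongrightarrow> 0) F"
      using tendsto_mult_right[OF assms(4), of "ip M g g"] by simp
  qed
  then show ?thesis using LIM_zero_iff by blast
qed

text \<open>Solve the expansion of \<open>sqdist M (f i) f0\<close> for the squared norm of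
  \<open>f i\<close>; every other term has a known limit.\<close>

lemma ip_self_tendsto:
  assumes "\<forall>\<^sub>F i in F. f i \<in> L2 M" "f0 \<in> L2 M" "((\<lambda>i. sqdist M (f i) f0) \<longlongrightarrow> 0) F"
  shows "((\<lambda>i. ip M (f i) (f i)) \<longlongrightarrow> ip M f0 f0) F"
proof -
  have "((\<lambda>i. sqdist M (f i) f0 + 2 * ip M (f i) f0 - ip M f0 f0) \<longlongrightarrow> 0 + 2 * ip M f0 f0 - ip M f0 f0) F"
    by (intro tendsto_intros assms ip_tendsto)
  moreover have "\<forall>\<^sub>F i in F. sqdist M (f i) f0 + 2 * ip M (f i) f0 - ip M f0 f0 = ip M (f i) (f i)"
    using assms(1) by eventually_elim (simp add: sqdist_expand assms(2))
  ultimately show ?thesis by (simp add: tendsto_cong)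
qed

lemma mean_square_dist_eq_sqdist:
  assumes "(\<lambda>\<omega>. f \<omega> - g \<omega>) \<in> L2 M"
  shows "mean_square_dist M f g = ennreal (sqdist M f g)"
  unfolding mean_square_dist_def sqdist_def
  by (rule nn_integral_eq_integral) (use assms in \<open>auto simp: L2_def\<close>)

lemma mean_square_dist_tendsto_iff:
  assumes "\<forall>\<^sub>F i in F. (\<lambda>\<omega>. f i \<omega> - g i \<omega>) \<in> L2 M"
  shows "((\<lambda>i. mean_square_dist M (f i) (g i)) \<longlongrightarrow> 0) F \<longleftrightarrow> ((\<lambda>i. sqdist M (f i) (g i)) \<longlongrightarrow> 0) F"
proof -
  have "((\<lambda>i. mean_square_dist M (f i) (g i)) \<longlongrightarrow> 0) F \<longleftrightarrow>
      ((\<lambda>i. ennreal (sqdist M (f i) (g i))) \<longlongrightarrow> ennreal 0) F"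
    unfolding ennreal_0 by (rule tendsto_cong, use assms in eventually_elim) (rule mean_square_dist_eq_sqdist)
  also have "\<dots> \<longleftrightarrow> ((\<lambda>i. sqdist M (f i) (g i)) \<longlongrightarrow> 0) F"
    by (rule tendsto_ennreal_iff) (simp_all add: sqdist_nonneg)
  finally show ?thesis .
qed

section \<open>Completeness and almost surely convergent subsequences\<close>

context prob_space begin

lemma L2_const: "(\<lambda>\<omega>. c) \<in> L2 M"
  by (simp add: L2_def)

lemma L2_integrable: "f \<in> L2 M \<Longrightarrow> integrable M f"
  using L2_integrable_mult[OF _ L2_const[of 1]] by simp

text \<open>Cauchy-Schwarz against the constant 1. It passes from mean-square to L1 convergence,
  from which almost sure subsequences are extracted.\<close>

lemma expectation_abs_square_le:
  assumes "f \<in> L2 M" shows "(\<integral>\<omega>. \<bar>f \<omega>\<bar> \<partial>M)\<^sup>2 \<le> ip M f f"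
proof -
  have "(\<lambda>\<omega>. \<bar>f \<omega>\<bar>) \<in> L2 M" using assms by (auto simp: L2_def)
  from ip_Cauchy_Schwarz[OF this L2_const[of 1]] show ?thesis
    by (simp add: ip_def prob_space)
qed

text \<open>Riesz-Fischer: a mean-square Cauchy sequence is L1-Cauchy, so a subsequence converges
  almost surely, and Fatou's lemma bounds the distance of \<open>f n\<close> to the pointwise
  limit.\<close>

lemma L2_complete:
  assumes f: "\<And>n. f n \<in> L2 M"
    and cau: "\<And>e. e > 0 \<Longrightarrow> \<exists>N. \<forall>i\<ge>N. \<forall>j\<ge>N. sqdist M (f i) (f j) < e"
  obtains g where "g \<in> L2 M" "(\<lambda>n. sqdist M (f n) g) \<longlonglongrightarrow> 0"
proof -
  have [measurable]: "f n \<in> borel_measurable M" for n using f by (simp add: L2_def)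
  have "\<exists>N. \<forall>i\<ge>N. \<forall>j\<ge>N. (LINT x|M. norm (f i x - f j x)) < e" if e: "e > 0" for e
  proof -
    obtain N where N: "\<And>i j. i \<ge> N \<Longrightarrow> j \<ge> N \<Longrightarrow> sqdist M (f i) (f j) < e\<^sup>2"
      using cau[OF zero_less_power[OF e, of 2]] by blast
    have "(LINT x|M. norm (f i x - f j x)) < e" if "i \<ge> N" "j \<ge> N" for i j
    proof -
      have "(LINT x|M. \<bar>f i x - f j x\<bar>)\<^sup>2 < e\<^sup>2"
        using expectation_abs_square_le[OF L2_diff[OF f[of i] f[of j]]] N[OF that]
        by (simp add: sqdist_eq_ip)
      then show ?thesis using \<open>e > 0\<close> by (simp add: power2_less_imp_less)
    qed
    then show ?thesis by blast
  qed
  then obtain r where r: "strict_mono r" "AE x in M. Cauchy (\<lambda>i. f (r i) x)"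
    using cauchy_L1_AE_cauchy_subseq[of M f] L2_integrable[OF f] by metis
  \<comment> \<open>On the null set of divergence \<open>lim\<close> has an arbitrary value, but
    \<open>g\<close> is measurable everywhere.\<close>
  define g where "g x = lim (\<lambda>i. f (r i) x)" for x
  have g [measurable]: "g \<in> borel_measurable M" unfolding g_def by measurable
  have conv: "AE x in M. (\<lambda>i. f (r i) x) \<longlonglongrightarrow> g x"
    using r(2) by eventually_elim (simp add: g_def Cauchy_convergent_iff convergent_LIMSEQ_iff)
  \<comment> \<open>Stated with the nonnegative integral because square-integrability of
    \<open>g\<close> is not known yet; it follows from this very bound.\<close>
  have bound: "(\<integral>\<^sup>+x. ennreal ((f n x - g x)\<^sup>2) \<partial>M) \<le> ennreal e"
    if N: "\<And>i j. i \<ge> N \<Longrightarrow> j \<ge> N \<Longrightarrow> sqdist M (f i) (f j) < e" and n: "n \<ge> N" for n N e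
  proof -
    have "AE x in M. liminf (\<lambda>i. ennreal ((f n x - f (r i) x)\<^sup>2)) = ennreal ((f n x - g x)\<^sup>2)"
      using conv
    proof eventually_elim
      case (elim x)
      then have "(\<lambda>i. ennreal ((f n x - f (r i) x)\<^sup>2)) \<longlonglongrightarrow> ennreal ((f n x - g x)\<^sup>2)"
        by (intro tendsto_intros)
      then show ?case by (rule lim_imp_Liminf[OF trivial_limit_sequentially])
    qed
    then have "(\<integral>\<^sup>+x. ennreal ((f n x - g x)\<^sup>2) \<partial>M)
        = (\<integral>\<^sup>+x. liminf (\<lambda>i. ennreal ((f n x - f (r i) x)\<^sup>2)) \<partial>M)"
      by (intro nn_integral_cong_AE) auto
    also have "\<dots> \<le> liminf (\<lambda>i. \<integral>\<^sup>+x. ennreal ((f n x - f (r i) x)\<^sup>2) \<partial>M)"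
      by (rule nn_integral_liminf) measurable
    also have "\<dots> \<le> limsup (\<lambda>i. \<integral>\<^sup>+x. ennreal ((f n x - f (r i) x)\<^sup>2) \<partial>M)"
      by (rule Liminf_le_Limsup[OF trivial_limit_sequentially])
    also have "\<dots> \<le> ennreal e"
    proof (rule Limsup_bounded, rule eventually_sequentiallyI[of N])
      fix i assume "i \<ge> N"
      then have "r i \<ge> N" using seq_suble[OF r(1), of i] by linarith
      then have "sqdist M (f n) (f (r i)) \<le> e" using N[OF n, of "r i"] by simp
      moreover have "(\<integral>\<^sup>+x. ennreal ((f n x - f (r i) x)\<^sup>2) \<partial>M) = ennreal (sqdist M (f n) (f (r i)))"
        using mean_square_dist_eq_sqdist[OF L2_diff[OF f[of n] f[of "r i"]]]
        by (simp add: mean_square_dist_def)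
      ultimately show "(\<integral>\<^sup>+x. ennreal ((f n x - f (r i) x)\<^sup>2) \<partial>M) \<le> ennreal e"
        by (simp add: ennreal_leI)
    qed
    finally show ?thesis .
  qed
  have gL2: "g \<in> L2 M"
  proof -
    obtain N where N: "\<And>i j. i \<ge> N \<Longrightarrow> j \<ge> N \<Longrightarrow> sqdist M (f i) (f j) < 1"
      using cau[OF zero_less_one] by blast
    have "(\<integral>\<^sup>+x. ennreal ((f N x - g x)\<^sup>2) \<partial>M) < \<infinity>"
      by (rule le_less_trans[OF bound[OF N order_refl]]) (simp_all add: ennreal_less_top)
    then have "integrable M (\<lambda>x. (f N x - g x)\<^sup>2)"
      by (intro integrableI_nonneg) auto
    then have "(\<lambda>x. f N x - g x) \<in> L2 M" by (simp add: L2_def)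
    from L2_diff[OF f[of N] this] show ?thesis by simp
  qed
  have "(\<lambda>n. sqdist M (f n) g) \<longlonglongrightarrow> 0"
  proof (rule LIMSEQ_I)
    fix e :: real assume "e > 0"
    then obtain N where N: "\<And>i j. i \<ge> N \<Longrightarrow> j \<ge> N \<Longrightarrow> sqdist M (f i) (f j) < e / 2"
      using cau[OF half_gt_zero[OF \<open>e > 0\<close>]] by blast
    have "norm (sqdist M (f n) g - 0) < e" if "n \<ge> N" for n
    proof -
      have "ennreal (sqdist M (f n) g) \<le> ennreal (e / 2)"
        using bound[OF N that] mean_square_dist_eq_sqdist[OF L2_diff[OF f[of n] gL2]]
        by (simp add: mean_square_dist_def)
      then show ?thesis using \<open>e > 0\<close> by (simp add: sqdist_nonneg)
    qed
    then show "\<exists>N. \<forall>n\<ge>N. norm (sqdist M (f n) g - 0) < e" by blast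
  qed
  with gL2 show ?thesis by (rule that)
qed

text \<open>This is what turns a mean-square limit into a pointwise formula in the parameters, as a
  network requires.\<close>

lemma L2_tendsto_AE_subseq:
  assumes f: "\<And>n. f n \<in> L2 M" and g: "g \<in> L2 M" and lim: "(\<lambda>n. sqdist M (f n) g) \<longlonglongrightarrow> 0"
  obtains r :: "nat \<Rightarrow> nat" where "strict_mono r" "AE \<omega> in M. (\<lambda>n. f (r n) \<omega>) \<longlonglongrightarrow> g \<omega>"
proof -
  have d: "(\<lambda>\<omega>. f n \<omega> - g \<omega>) \<in> L2 M" for n by (rule L2_diff[OF f g])
  have "(\<lambda>n. \<integral>x. norm (f n x - g x) \<partial>M) \<longlonglongrightarrow> 0"
  proof (rule tendsto_zero_of_square[OF _ lim])
    show "\<forall>\<^sub>F n in sequentially. (\<integral>x. norm (f n x - g x) \<partial>M)\<^sup>2 \<le> sqdist M (f n) g"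
      using expectation_abs_square_le[OF d] by (simp add: sqdist_eq_ip)
  qed
  then obtain r where "strict_mono r" "AE x in M. (\<lambda>n. f (r n) x - g x) \<longlonglongrightarrow> 0"
    using tendsto_L1_AE_subseq[of M "\<lambda>n x. f n x - g x"] L2_integrable[OF d] by blast
  then show ?thesis by (intro that) (simp_all only: LIM_zero_iff)
qed

end

section \<open>Existence of the decomposition\<close>

locale centered_ms_process = prob_space M for M :: "'w measure" +
  fixes a b :: real and y :: "real \<Rightarrow> 'w \<Rightarrow> real"
  assumes ab: "a < b"
    and yL2: "\<And>t. t \<in> {a..b} \<Longrightarrow> y t \<in> L2 M"
    and mean_zero: "\<And>t. t \<in> {a..b} \<Longrightarrow> (\<integral>\<omega>. y t \<omega> \<partial>M) = 0"
    and ms_cont: "\<And>t. t \<in> {a..b} \<Longrightarrow> ((\<lambda>s. sqdist M (y s) (y t)) \<longlongrightarrow> 0) (at t within {a..b})"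
begin

text \<open>The map written \<open>\<xi>\<^sup>*\<close> in the overview. The functions
  \<open>e k\<close> of the decomposition will be of this form.\<close>

definition corr :: "('w \<Rightarrow> real) \<Rightarrow> real \<Rightarrow> real" where
  "corr \<xi> t = ip M \<xi> (y t)"

text \<open>The quadratic form of \<open>A\<^sup>* A\<close>, where \<open>A\<close> sends \<xi> to
  \<open>corr \<xi>\<close> in the square-integrable functions on [a, b]; its maximal values are
  squared singular values of \<open>A\<close>.\<close>

definition energy :: "('w \<Rightarrow> real) \<Rightarrow> ('w \<Rightarrow> real) \<Rightarrow> real" where
  "energy \<xi> \<eta> = integral {a..b} (\<lambda>t. corr \<xi> t * corr \<eta> t)"

lemma eventually_yL2: "\<forall>\<^sub>F s in at t within {a..b}. y s \<in> L2 M"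
  unfolding eventually_at_filter by (simp add: yL2)

lemma continuous_variance: "continuous_on {a..b} (\<lambda>t. ip M (y t) (y t))"
  unfolding continuous_on_def using ip_self_tendsto[OF eventually_yL2 yL2 ms_cont] by blast

lemma variance_bounded:
  obtains C where "0 < C" "\<And>t. t \<in> {a..b} \<Longrightarrow> ip M (y t) (y t) \<le> C"
proof -
  have "bounded ((\<lambda>t. ip M (y t) (y t)) ` {a..b})"
    by (intro compact_imp_bounded compact_continuous_image continuous_variance compact_Icc)
  then obtain C where "C > 0" "\<forall>x \<in> (\<lambda>t. ip M (y t) (y t)) ` {a..b}. norm x \<le> C"
    unfolding bounded_pos by blast
  then show ?thesis by (intro that[of C]) (auto dest: abs_le_D1)
qed

lemma corr_square_le:
  "\<xi> \<in> L2 M \<Longrightarrow> t \<in> {a..b} \<Longrightarrow> (corr \<xi> t)\<^sup>2 \<le> ip M \<xi> \<xi> * ip M (y t) (y t)"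
  unfolding corr_def by (rule ip_Cauchy_Schwarz[OF _ yL2])

text \<open>The bound depends on \<xi> only through its norm, so the functions
  \<open>corr \<xi>\<close> with \<xi> in the unit ball are equicontinuous.\<close>

lemma corr_increment_square_le:
  assumes "\<xi> \<in> L2 M" "t \<in> {a..b}" "s \<in> {a..b}"
  shows "(corr \<xi> t - corr \<xi> s)\<^sup>2 \<le> ip M \<xi> \<xi> * sqdist M (y t) (y s)"
  using ip_Cauchy_Schwarz[OF assms(1) L2_diff[OF yL2[OF assms(2)] yL2[OF assms(3)]]]
  by (simp add: corr_def ip_diff_right[OF yL2[OF assms(2)] yL2[OF assms(3)] assms(1)] sqdist_eq_ip)

lemma continuous_corr:
  assumes "\<xi> \<in> L2 M" shows "continuous_on {a..b} (corr \<xi>)"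
  unfolding continuous_on_def
proof
  fix t assume t: "t \<in> {a..b}"
  have "((\<lambda>s. ip M (y s) \<xi>) \<longlongrightarrow> ip M (y t) \<xi>) (at t within {a..b})"
    by (rule ip_tendsto[OF eventually_yL2 yL2[OF t] assms ms_cont[OF t]])
  then show "(corr \<xi> \<longlongrightarrow> corr \<xi> t) (at t within {a..b})"
    unfolding corr_def ip_commute[of M \<xi>] .
qed

lemma integrable_corr_mult:
  "\<xi> \<in> L2 M \<Longrightarrow> \<eta> \<in> L2 M \<Longrightarrow> (\<lambda>t. corr \<xi> t * corr \<eta> t) integrable_on {a..b}"
  by (intro integrable_continuous_real continuous_on_mult continuous_corr)

lemma corr_add_scaled:
  "\<xi> \<in> L2 M \<Longrightarrow> \<eta> \<in> L2 M \<Longrightarrow> t \<in> {a..b} \<Longrightarrow> corr (\<lambda>\<omega>. \<xi> \<omega> + s * \<eta> \<omega>) t = corr \<xi> t + s * corr \<eta> t"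
  unfolding corr_def by (simp add: ip_add_left L2_scale yL2 ip_scale_left)

lemma energy_commute: "energy \<xi> \<eta> = energy \<eta> \<xi>"
  by (simp add: energy_def mult.commute)

lemma energy_nonneg: "\<xi> \<in> L2 M \<Longrightarrow> 0 \<le> energy \<xi> \<xi>"
  unfolding energy_def by (rule integral_nonneg[OF integrable_corr_mult]) auto

lemma energy_add_scaled_self:
  assumes "\<xi> \<in> L2 M" "\<eta> \<in> L2 M"
  shows "energy (\<lambda>\<omega>. \<xi> \<omega> + s * \<eta> \<omega>) (\<lambda>\<omega>. \<xi> \<omega> + s * \<eta> \<omega>)
    = energy \<xi> \<xi> + 2 * s * energy \<xi> \<eta> + s\<^sup>2 * energy \<eta> \<eta>"
proof -
  have "energy (\<lambda>\<omega>. \<xi> \<omega> + s * \<eta> \<omega>) (\<lambda>\<omega>. \<xi> \<omega> + s * \<eta> \<omega>) =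
    integral {a..b} (\<lambda>t. corr \<xi> t * corr \<xi> t + (2 * s) * (corr \<xi> t * corr \<eta> t) + s\<^sup>2 * (corr \<eta> t * corr \<eta> t))"
    unfolding energy_def
    by (rule integral_cong) (simp add: corr_add_scaled assms algebra_simps power2_eq_square)
  also have "\<dots> = energy \<xi> \<xi> + 2 * s * energy \<xi> \<eta> + s\<^sup>2 * energy \<eta> \<eta>"
  proof -
    have "(\<lambda>t. corr \<xi> t * corr \<xi> t) integrable_on {a..b}"
      "(\<lambda>t. (2 * s) * (corr \<xi> t * corr \<eta> t)) integrable_on {a..b}"
      "(\<lambda>t. s\<^sup>2 * (corr \<eta> t * corr \<eta> t)) integrable_on {a..b}"
      by (intro integrable_on_mult_right integrable_corr_mult assms)+
    then show ?thesis
      unfolding energy_def by (simp only: integral_add integrable_add integral_mult_right)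
  qed
  finally show ?thesis .
qed

lemma energy_Cauchy_Schwarz:
  assumes "\<xi> \<in> L2 M" "\<eta> \<in> L2 M" shows "(energy \<xi> \<eta>)\<^sup>2 \<le> energy \<xi> \<xi> * energy \<eta> \<eta>"
proof (rule quadratic_nonneg_imp_discriminant)
  fix s show "0 \<le> energy \<xi> \<xi> + 2 * s * energy \<xi> \<eta> + s\<^sup>2 * energy \<eta> \<eta>"
    unfolding energy_add_scaled_self[OF assms, of s, symmetric]
    by (intro energy_nonneg L2_add L2_scale assms)
qed

lemma energy_le:
  assumes "\<xi> \<in> L2 M" "\<And>t. t \<in> {a..b} \<Longrightarrow> (corr \<xi> t)\<^sup>2 \<le> K"
  shows "energy \<xi> \<xi> \<le> (b - a) * K"
proof -
  have "energy \<xi> \<xi> \<le> integral {a..b} (\<lambda>t. K)"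
    unfolding energy_def using assms(2)
    by (intro integral_le integrable_corr_mult assms(1) integrable_const_ivl) (auto simp: power2_eq_square)
  then show ?thesis using ab by simp
qed

text \<open>Continuity of \<open>corr \<xi>\<close> excludes exceptional times. This is why the
  expansion holds at every \<open>t\<close> and not merely at almost every one.\<close>

lemma energy_zero_imp_corr_zero:
  assumes "\<xi> \<in> L2 M" "energy \<xi> \<xi> = 0" "t \<in> {a..b}" shows "corr \<xi> t = 0"
proof -
  have "\<forall>x\<in>{a..b}. corr \<xi> x * corr \<xi> x = 0"
  proof (rule integral_eq_0_iff[THEN iffD1])
    show "continuous_on {a..b} (\<lambda>x. corr \<xi> x * corr \<xi> x)"
      by (intro continuous_on_mult continuous_corr assms(1))
    show "integral {a..b} (\<lambda>x. corr \<xi> x * corr \<xi> x) = 0"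
      using assms(2) by (simp add: energy_def)
  qed (use ab in auto)
  then show ?thesis using assms(3) by simp
qed

text \<open>A maximising sequence has a subsequence along which \<open>corr\<close> converges uniformly (Arzela-Ascoli);
  since midpoints cannot exceed the supremum, the parallelogram law makes that subsequence Cauchy
  in \<open>L2 M\<close>. The last property says that the maximiser is normalised unless it has energy 0.\<close>

lemma energy_maximizer:
  assumes Z: "Z \<subseteq> L2 M" and V: "V = {\<xi> \<in> L2 M. \<forall>\<zeta>\<in>Z. ip M \<xi> \<zeta> = 0}"
  obtains \<xi> where "\<xi> \<in> V"
    "\<And>\<eta>. \<eta> \<in> V \<Longrightarrow> energy \<eta> \<eta> \<le> energy \<xi> \<xi> * ip M \<eta> \<eta>"
    "\<And>\<eta>. \<eta> \<in> V \<Longrightarrow> energy \<xi> \<eta> = energy \<xi> \<xi> * ip M \<xi> \<eta>"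
    "\<And>t. t \<in> {a..b} \<Longrightarrow> corr \<xi> t * ip M \<xi> \<xi> = corr \<xi> t"
proof -
  obtain C where C: "0 < C" "\<And>t. t \<in> {a..b} \<Longrightarrow> ip M (y t) (y t) \<le> C"
    using variance_bounded by blast
  have VL2: "\<xi> \<in> L2 M" if "\<xi> \<in> V" for \<xi> using that V by blast
  have V_lin: "(\<lambda>\<omega>. \<xi> \<omega> + s * \<eta> \<omega>) \<in> V" if "\<xi> \<in> V" "\<eta> \<in> V" for \<xi> \<eta> s
  proof -
    have "ip M (\<lambda>\<omega>. \<xi> \<omega> + s * \<eta> \<omega>) \<zeta> = 0" if "\<zeta> \<in> Z" for \<zeta>
      using that Z \<open>\<xi> \<in> V\<close> \<open>\<eta> \<in> V\<close> unfolding V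
      by (subst ip_add_left) (auto simp: ip_scale_left intro: L2_scale)
    then show ?thesis using VL2[OF \<open>\<xi> \<in> V\<close>] VL2[OF \<open>\<eta> \<in> V\<close>] unfolding V
      by (auto intro: L2_add L2_scale)
  qed
  have V0: "(\<lambda>\<omega>. 0) \<in> V" by (simp add: V L2_zero ip_def)
  \<comment> \<open>Boundedness of the form makes the supremum finite and \<open>energy\<close>
    continuous under mean-square limits.\<close>
  have bnd: "energy \<eta> \<eta> \<le> (b - a) * (ip M \<eta> \<eta> * C)" if "\<eta> \<in> L2 M" for \<eta>
  proof (rule energy_le[OF that])
    fix t assume t: "t \<in> {a..b}"
    have "(corr \<eta> t)\<^sup>2 \<le> ip M \<eta> \<eta> * ip M (y t) (y t)" by (rule corr_square_le[OF that t])
    also have "\<dots> \<le> ip M \<eta> \<eta> * C" by (intro mult_left_mono C(2) t ip_self_nonneg)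
    finally show "(corr \<eta> t)\<^sup>2 \<le> ip M \<eta> \<eta> * C" .
  qed
  define S where "S = {energy \<eta> \<eta> | \<eta>. \<eta> \<in> V \<and> ip M \<eta> \<eta> \<le> 1}"
  define lam where "lam = Sup S"
  have z: "energy (\<lambda>\<omega>. 0) \<eta> = 0" for \<eta> by (simp add: energy_def corr_def ip_def)
  have S0: "0 \<in> S" unfolding S_def using V0 z[of "\<lambda>\<omega>. 0"] by (force simp: ip_def)
  have bdd: "bdd_above S"
  proof (rule bdd_aboveI[of _ "(b - a) * C"])
    fix x assume "x \<in> S"
    then obtain \<eta> where \<eta>: "x = energy \<eta> \<eta>" "\<eta> \<in> V" "ip M \<eta> \<eta> \<le> 1" unfolding S_def by blast
    have "ip M \<eta> \<eta> * C \<le> 1 * C" using \<eta>(3) C(1) by (intro mult_right_mono) auto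
    then have "(b - a) * (ip M \<eta> \<eta> * C) \<le> (b - a) * C" using ab by (intro mult_left_mono) auto
    then show "x \<le> (b - a) * C" using bnd[OF VL2[OF \<eta>(2)]] \<eta>(1) by linarith
  qed
  have lam0: "0 \<le> lam" unfolding lam_def by (rule cSup_upper[OF S0 bdd])
  \<comment> \<open>The homogeneous form of the supremum. A null vector cannot be normalised, so
    that case rests on \<open>bnd\<close>.\<close>
  have le_lam: "energy \<eta> \<eta> \<le> lam * ip M \<eta> \<eta>" if "\<eta> \<in> V" for \<eta>
  proof (cases "ip M \<eta> \<eta> = 0")
    case True
    then show ?thesis using bnd[OF VL2[OF that]] by simp
  next
    case False
    then have pos: "ip M \<eta> \<eta> > 0" using ip_self_nonneg[of M \<eta>] by linarith
    define c where "c = 1 / sqrt (ip M \<eta> \<eta>)"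
    have c2: "c\<^sup>2 = 1 / ip M \<eta> \<eta>" using pos by (simp add: c_def power_divide)
    \<comment> \<open>The summand 0 brings the scaled vector into the shape of the expansion
      lemmas.\<close>
    have "(\<lambda>\<omega>. 0 + c * \<eta> \<omega>) \<in> V" by (rule V_lin[OF V0 that])
    moreover have "ip M (\<lambda>\<omega>. 0 + c * \<eta> \<omega>) (\<lambda>\<omega>. 0 + c * \<eta> \<omega>) = 1"
      using c2 pos by (simp only: ip_add_scaled_self[OF L2_zero VL2[OF that]]) (simp add: ip_def)
    moreover have "energy (\<lambda>\<omega>. 0 + c * \<eta> \<omega>) (\<lambda>\<omega>. 0 + c * \<eta> \<omega>) = energy \<eta> \<eta> / ip M \<eta> \<eta>"
      by (simp only: energy_add_scaled_self[OF L2_zero VL2[OF that]] z c2) simp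
    ultimately have "energy \<eta> \<eta> / ip M \<eta> \<eta> \<in> S" unfolding S_def by force
    then have "energy \<eta> \<eta> / ip M \<eta> \<eta> \<le> lam" unfolding lam_def by (rule cSup_upper[OF _ bdd])
    then show ?thesis using pos by (simp add: field_simps)
  qed
  \<comment> \<open>The third property encodes norm 1 for \<open>lam > 0\<close> and leaves room for
    the zero vector when \<open>lam = 0\<close>.\<close>
  obtain \<xi> where \<xi>: "\<xi> \<in> V" "energy \<xi> \<xi> = lam" "lam * ip M \<xi> \<xi> = lam"
  proof (cases "lam = 0")
    case True
    then show ?thesis using that[OF V0] z by simp
  next
    case False
    then have lam_pos: "lam > 0" using lam0 by simp
    have "\<exists>\<eta>. \<eta> \<in> V \<and> ip M \<eta> \<eta> \<le> 1 \<and> energy \<eta> \<eta> > lam - 1 / real (Suc n)" for n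
    proof -
      have "lam - 1 / real (Suc n) < Sup S" unfolding lam_def by simp
      then show ?thesis using less_cSup_iff[OF _ bdd] S0 unfolding S_def by blast
    qed
    then obtain f where f: "\<And>n. f n \<in> V" "\<And>n. ip M (f n) (f n) \<le> 1"
        "\<And>n. energy (f n) (f n) > lam - 1 / real (Suc n)" by metis
    note fL2 = VL2[OF f(1)]
    obtain g k where k: "strict_mono (k :: nat \<Rightarrow> nat)"
      and unif: "\<And>e. 0 < e \<Longrightarrow> \<exists>N. \<forall>n x. n \<ge> N \<and> x \<in> {a..b} \<longrightarrow> norm (corr (f (k n)) x - g x) < e"
    proof (rule Arzela_Ascoli[of "{a..b}" "\<lambda>n. corr (f n)" "sqrt C"])
      fix n t assume t: "t \<in> {a..b}"
      have "(corr (f n) t)\<^sup>2 \<le> ip M (f n) (f n) * ip M (y t) (y t)" by (rule corr_square_le[OF fL2 t])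
      also have "\<dots> \<le> 1 * C" by (intro mult_mono f C(2) t ip_self_nonneg) simp
      finally show "norm (corr (f n) t) \<le> sqrt C" by (intro real_le_rsqrt) simp
    next
      fix t e :: real assume t: "t \<in> {a..b}" and e: "0 < e"
      have "\<forall>\<^sub>F s in at t within {a..b}. sqdist M (y s) (y t) < e\<^sup>2"
        using order_tendstoD(2)[OF ms_cont[OF t], of "e\<^sup>2"] e by simp
      then obtain d where d: "d > 0"
        "\<And>s. s \<in> {a..b} \<Longrightarrow> s \<noteq> t \<Longrightarrow> dist s t < d \<Longrightarrow> sqdist M (y s) (y t) < e\<^sup>2"
        unfolding eventually_at by blast
      have "norm (corr (f n) t - corr (f n) s) < e" if s: "s \<in> {a..b}" "norm (t - s) < d" for n s
      \<comment> \<open>The filter \<open>at t within {a..b}\<close> is punctured and says nothing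
        about \<open>s = t\<close>.\<close>
      proof (cases "s = t")
        case False
        have "(corr (f n) t - corr (f n) s)\<^sup>2 \<le> ip M (f n) (f n) * sqdist M (y t) (y s)"
          by (rule corr_increment_square_le[OF fL2 t s(1)])
        also have "\<dots> \<le> 1 * sqdist M (y t) (y s)" by (intro mult_right_mono f sqdist_nonneg)
        also have "\<dots> < e\<^sup>2"
          using d(2)[OF s(1) False] s(2) by (simp add: sqdist_commute[of M "y t"] dist_norm norm_minus_commute)
        finally show ?thesis using e by (metis abs_le_square_iff abs_of_pos linorder_not_less real_norm_def)
      qed (use e in simp)
      then show "\<exists>d>0. \<forall>n s. s \<in> {a..b} \<and> norm (t - s) < d \<longrightarrow> norm (corr (f n) t - corr (f n) s) < e"
        using d(1) by blast
    qed (auto intro: compact_Icc)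
    \<comment> \<open>Parallelogram law for \<open>energy\<close> and for the norm: the energies of
      sum and difference add up to more than \<open>4 * lam - 2 / Suc i - 2 / Suc j\<close>, while
      the sum has energy at most \<open>lam * (4 - sqdist M (f i) (f j))\<close>.\<close>
    have gap: "lam * sqdist M (f i) (f j) \<le>
        2 / real (Suc i) + 2 / real (Suc j) + energy (\<lambda>\<omega>. f i \<omega> - f j \<omega>) (\<lambda>\<omega>. f i \<omega> - f j \<omega>)" for i j
    proof -
      let ?p = "\<lambda>\<omega>. f i \<omega> + 1 * f j \<omega>"
      have "energy ?p ?p \<le> lam * ip M ?p ?p" by (rule le_lam[OF V_lin[OF f(1) f(1)]])
      moreover have "energy ?p ?p = energy (f i) (f i) + 2 * energy (f i) (f j) + energy (f j) (f j)"
        using energy_add_scaled_self[OF fL2 fL2, of i 1 j] by simp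
      moreover have "energy (\<lambda>\<omega>. f i \<omega> - f j \<omega>) (\<lambda>\<omega>. f i \<omega> - f j \<omega>)
          = energy (f i) (f i) - 2 * energy (f i) (f j) + energy (f j) (f j)"
        using energy_add_scaled_self[OF fL2 fL2, of i "-1" j] by simp
      moreover have "ip M ?p ?p + sqdist M (f i) (f j) = 2 * ip M (f i) (f i) + 2 * ip M (f j) (f j)"
        using ip_add_scaled_self[OF fL2 fL2, of i 1 j] sqdist_expand[OF fL2 fL2, of i j] by simp
      then have "ip M ?p ?p \<le> 4 - sqdist M (f i) (f j)" using f(2)[of i] f(2)[of j] by linarith
      then have "lam * ip M ?p ?p \<le> lam * (4 - sqdist M (f i) (f j))"
        using lam0 by (intro mult_left_mono)
      moreover have "lam - 1 / real (Suc i) < energy (f i) (f i)" "lam - 1 / real (Suc j) < energy (f j) (f j)"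
        by (rule f(3))+
      moreover have "2 / real (Suc n) = 2 * (1 / real (Suc n))" for n by simp
      ultimately show ?thesis by (simp add: algebra_simps)
    qed
    have "\<exists>N. \<forall>i\<ge>N. \<forall>j\<ge>N. sqdist M (f (k i)) (f (k j)) < e" if e: "e > 0" for e
    proof -
      \<comment> \<open>Each of the three terms in \<open>gap\<close> will be at most
        \<open>d\<close>, with the first two strictly below it, so they stay below
        \<open>4 * d = e * lam\<close>. The choice of \<open>c\<close> makes the energy term fit:
        two functions \<open>c\<close>-close to \<open>g\<close> differ by at most
        \<open>2 * c\<close>.\<close>
      define d where "d = e * lam / 4"
      have d: "d > 0" using e lam_pos by (simp add: d_def)
      define c where "c = sqrt (d / (b - a)) / 2"
      have c: "c > 0" using d ab by (simp add: c_def)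
      have c2: "(b - a) * (2 * c)\<^sup>2 = d" using d ab by (simp add: c_def)
      obtain N1 where N1: "\<And>n x. n \<ge> N1 \<Longrightarrow> x \<in> {a..b} \<Longrightarrow> norm (corr (f (k n)) x - g x) < c"
        using unif[OF c] by blast
      obtain N2 where N2: "2 / d < real N2" using reals_Archimedean2 by blast
      have small: "2 / real (Suc (k n)) < d" if "n \<ge> N2" for n
      proof -
        have "real N2 \<le> real (Suc (k n))" using seq_suble[OF k, of n] that by linarith
        then have "2 / d < real (Suc (k n))" using N2 by linarith
        then show ?thesis using d by (simp add: field_simps)
      qed
      have "sqdist M (f (k i)) (f (k j)) < e" if ij: "i \<ge> max N1 N2" "j \<ge> max N1 N2" for i j
      proof -
        let ?h = "\<lambda>\<omega>. f (k i) \<omega> - f (k j) \<omega>"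
        have "(corr ?h t)\<^sup>2 \<le> (2 * c)\<^sup>2" if t: "t \<in> {a..b}" for t
        proof -
          have "corr ?h t = corr (f (k i)) t - corr (f (k j)) t"
            using corr_add_scaled[OF fL2 fL2 t, of "k i" "-1" "k j"] by simp
          moreover have "norm (corr (f (k i)) t - g t) < c" "norm (corr (f (k j)) t - g t) < c"
            using N1 ij t by auto
          ultimately have "\<bar>corr ?h t\<bar> \<le> 2 * c" by (simp add: abs_le_iff abs_less_iff)
          then show ?thesis using power_mono[of "\<bar>corr ?h t\<bar>" "2 * c" 2] by simp
        qed
        then have "energy ?h ?h \<le> (b - a) * (2 * c)\<^sup>2"
          by (rule energy_le[OF L2_diff[OF fL2 fL2]])
        then have "lam * sqdist M (f (k i)) (f (k j)) < 4 * d"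
          using gap[of "k i" "k j"] small[of i] small[of j] ij c2 d by linarith
        then show ?thesis using lam_pos by (simp add: d_def mult.commute)
      qed
      then show ?thesis by blast
    qed
    then obtain \<xi> where \<xi>L2: "\<xi> \<in> L2 M" and lim: "(\<lambda>n. sqdist M (f (k n)) \<xi>) \<longlonglongrightarrow> 0"
      using L2_complete[of "\<lambda>n. f (k n)"] fL2 by metis
    have ev: "\<forall>\<^sub>F n in sequentially. f (k n) \<in> L2 M" using fL2 by simp
    have "ip M \<xi> \<zeta> = 0" if "\<zeta> \<in> Z" for \<zeta>
    proof -
      have "(\<lambda>n. ip M (f (k n)) \<zeta>) \<longlonglongrightarrow> ip M \<xi> \<zeta>"
        using ip_tendsto[OF ev \<xi>L2 _ lim] that Z by blast
      moreover have "(\<lambda>n. ip M (f (k n)) \<zeta>) = (\<lambda>n. 0)" using f(1) that unfolding V by blast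
      ultimately show ?thesis by (simp add: LIMSEQ_const_iff)
    qed
    then have \<xi>V: "\<xi> \<in> V" using \<xi>L2 unfolding V by blast
    have le1: "ip M \<xi> \<xi> \<le> 1"
      by (rule LIMSEQ_le_const2[OF ip_self_tendsto[OF ev \<xi>L2 lim]]) (use f(2) in blast)
    have e_ge: "lam \<le> energy \<xi> \<xi>"
    proof -
      \<comment> \<open>Expanding around the limit: the energy of \<open>h n\<close> tends to 0 by
        \<open>bnd\<close>, and the mixed term by Cauchy-Schwarz for \<open>energy\<close>.\<close>
      define h where "h n = (\<lambda>\<omega>. f (k n) \<omega> - \<xi> \<omega>)" for n
      have hL2: "h n \<in> L2 M" for n unfolding h_def by (rule L2_diff[OF fL2 \<xi>L2])
      have eh: "(\<lambda>n. energy (h n) (h n)) \<longlonglongrightarrow> 0"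
      proof (rule tendsto_sandwich[OF _ _ tendsto_const])
        show "\<forall>\<^sub>F n in sequentially. 0 \<le> energy (h n) (h n)" using energy_nonneg[OF hL2] by simp
        show "\<forall>\<^sub>F n in sequentially. energy (h n) (h n) \<le> (b - a) * (sqdist M (f (k n)) \<xi> * C)"
          using bnd[OF hL2] by (simp add: h_def sqdist_eq_ip)
        have "(\<lambda>n. (b - a) * (sqdist M (f (k n)) \<xi> * C)) \<longlonglongrightarrow> (b - a) * (0 * C)"
          by (intro tendsto_intros lim)
        then show "(\<lambda>n. (b - a) * (sqdist M (f (k n)) \<xi> * C)) \<longlonglongrightarrow> 0" by simp
      qed
      have ex: "(\<lambda>n. energy \<xi> (h n)) \<longlonglongrightarrow> 0"
      proof (rule tendsto_zero_of_square)
        show "\<forall>\<^sub>F n in sequentially. (energy \<xi> (h n))\<^sup>2 \<le> energy \<xi> \<xi> * energy (h n) (h n)"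
          using energy_Cauchy_Schwarz[OF \<xi>L2 hL2] by simp
        show "(\<lambda>n. energy \<xi> \<xi> * energy (h n) (h n)) \<longlonglongrightarrow> 0"
          using tendsto_mult_left[OF eh, of "energy \<xi> \<xi>"] by simp
      qed
      have "energy (f (k n)) (f (k n)) = energy \<xi> \<xi> + 2 * energy \<xi> (h n) + energy (h n) (h n)" for n
        using energy_add_scaled_self[OF \<xi>L2 hL2, of 1 n] by (simp add: h_def)
      moreover have "lam - 1 / real (Suc n) \<le> energy (f (k n)) (f (k n))" for n
      proof -
        have "1 / real (Suc (k n)) \<le> 1 / real (Suc n)"
          using seq_suble[OF k, of n] by (intro divide_left_mono) auto
        then show ?thesis using f(3)[of "k n"] by linarith
      qed
      ultimately have "lam - 1 / real (Suc n) \<le> energy \<xi> \<xi> + 2 * energy \<xi> (h n) + energy (h n) (h n)" for n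
        by metis
      moreover have "(\<lambda>n. energy \<xi> \<xi> + 2 * energy \<xi> (h n) + energy (h n) (h n)) \<longlonglongrightarrow> energy \<xi> \<xi> + 2 * 0 + 0"
        by (intro tendsto_intros eh ex)
      moreover have "(\<lambda>n. lam - 1 / real (Suc n)) \<longlonglongrightarrow> lam - 0"
        by (intro tendsto_intros LIMSEQ_Suc lim_1_over_n)
      ultimately show ?thesis using LIMSEQ_le[of "\<lambda>n. lam - 1 / real (Suc n)" "lam - 0"] by auto
    qed
    have "lam * ip M \<xi> \<xi> \<le> lam * 1" using le1 lam0 by (rule mult_left_mono)
    with e_ge le_lam[OF \<xi>V] have "energy \<xi> \<xi> = lam" "lam * ip M \<xi> \<xi> = lam" by linarith+
    then show ?thesis using that \<xi>V by blast
  qed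
  have opt: "energy \<xi> \<eta> = energy \<xi> \<xi> * ip M \<xi> \<eta>" if "\<eta> \<in> V" for \<eta>
  proof -
    \<comment> \<open>Along \<xi> + s \<eta> the defect \<open>lam * ip - energy\<close> is a
      nonnegative quadratic in \<open>s\<close> with constant term 0, so its linear coefficient
      vanishes.\<close>
    have "(lam * ip M \<xi> \<eta> - energy \<xi> \<eta>)\<^sup>2 \<le> 0 * (lam * ip M \<eta> \<eta> - energy \<eta> \<eta>)"
    proof (rule quadratic_nonneg_imp_discriminant)
      fix s
      have "energy (\<lambda>\<omega>. \<xi> \<omega> + s * \<eta> \<omega>) (\<lambda>\<omega>. \<xi> \<omega> + s * \<eta> \<omega>)
          \<le> lam * ip M (\<lambda>\<omega>. \<xi> \<omega> + s * \<eta> \<omega>) (\<lambda>\<omega>. \<xi> \<omega> + s * \<eta> \<omega>)"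
        by (rule le_lam[OF V_lin[OF \<xi>(1) that]])
      then show "0 \<le> 0 + 2 * s * (lam * ip M \<xi> \<eta> - energy \<xi> \<eta>) + s\<^sup>2 * (lam * ip M \<eta> \<eta> - energy \<eta> \<eta>)"
        using \<xi>(2,3) by (simp add: energy_add_scaled_self ip_add_scaled_self VL2 \<xi>(1) that algebra_simps)
    qed
    then show ?thesis using \<xi>(2) by simp
  qed
  have unit: "corr \<xi> t * ip M \<xi> \<xi> = corr \<xi> t" if "t \<in> {a..b}" for t
  proof (cases "lam = 0")
    case True
    then show ?thesis using energy_zero_imp_corr_zero[OF VL2[OF \<xi>(1)] _ that] \<xi>(2) by simp
  next
    case False
    then show ?thesis using \<xi>(3) by simp
  qed
  show ?thesis
    by (rule that[OF \<xi>(1)]) (use le_lam opt unit \<xi>(2) in auto)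
qed

theorem kkl_decomposition_exists: "\<exists>\<theta> e. kkl_decomposition a b M y \<theta> e"
proof -
  \<comment> \<open>Adjoining the constant 1 to the constraints gives all chosen variables mean 0,
    so that orthogonal means uncorrelated.\<close>
  define V where "V Z = {\<xi> \<in> L2 M. \<forall>\<zeta>\<in>insert (\<lambda>_. 1) Z. ip M \<xi> \<zeta> = 0}" for Z
  define maximizer where "maximizer Z \<xi> \<longleftrightarrow> \<xi> \<in> V Z \<and>
      (\<forall>\<eta>\<in>V Z. energy \<eta> \<eta> \<le> energy \<xi> \<xi> * ip M \<eta> \<eta>) \<and>
      (\<forall>\<eta>\<in>V Z. energy \<xi> \<eta> = energy \<xi> \<xi> * ip M \<xi> \<eta>) \<and>
      (\<forall>t\<in>{a..b}. corr \<xi> t * ip M \<xi> \<xi> = corr \<xi> t)" for Z \<xi>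
  define pick where "pick Z = (SOME \<xi>. maximizer Z \<xi>)" for Z
  have pick: "maximizer Z (pick Z)" if "Z \<subseteq> L2 M" for Z
  proof -
    have "insert (\<lambda>_. 1) Z \<subseteq> L2 M" using that L2_const by blast
    from energy_maximizer[OF this V_def] have "\<exists>\<xi>. maximizer Z \<xi>"
      unfolding maximizer_def by metis
    then show ?thesis unfolding pick_def by (rule someI_ex)
  qed
  \<comment> \<open>The recursion carries the set of all earlier choices, since each choice depends
    on all of them.\<close>
  define Z where "Z = rec_nat {} (\<lambda>_ Y. insert (pick Y) Y)"
  define \<xi> where "\<xi> n = pick (Z n)" for n
  have Z0: "Z 0 = {}" and ZSuc: "Z (Suc n) = insert (\<xi> n) (Z n)" for n
    by (simp_all add: Z_def \<xi>_def)
  have Z_eq: "Z n = \<xi> ` {..<n}" for n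
    by (induction n) (simp_all add: Z0 ZSuc lessThan_Suc)
  have ZL2: "Z n \<subseteq> L2 M" for n
  proof (induction n)
    case (Suc n)
    then have "\<xi> n \<in> L2 M" using pick[of "Z n"] unfolding maximizer_def V_def \<xi>_def by blast
    then show ?case using Suc by (simp add: ZSuc)
  qed (simp add: Z0)
  have max: "maximizer (Z n) (\<xi> n)" for n unfolding \<xi>_def by (rule pick[OF ZL2])
  have \<xi>V: "\<xi> n \<in> V (Z n)" for n using max unfolding maximizer_def by blast
  then have \<xi>L2: "\<xi> n \<in> L2 M" for n unfolding V_def by blast
  have \<xi>mean: "ip M (\<xi> n) (\<lambda>_. 1) = 0" for n using \<xi>V unfolding V_def by blast
  have orth_less: "ip M (\<xi> n) (\<xi> j) = 0" if "j < n" for j n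
    using \<xi>V[of n] that unfolding V_def Z_eq by blast
  have orth: "ip M (\<xi> n) (\<xi> j) = 0" if "j \<noteq> n" for j n
    using that orth_less[of j n] orth_less[of n j] ip_commute[of M "\<xi> n" "\<xi> j"]
    by (cases "j < n") auto
  have energy_le_V: "energy \<eta> \<eta> \<le> energy (\<xi> n) (\<xi> n) * ip M \<eta> \<eta>" if "\<eta> \<in> V (Z n)" for n \<eta>
    using max that unfolding maximizer_def by blast
  have energy_eq_V: "energy (\<xi> n) \<eta> = energy (\<xi> n) (\<xi> n) * ip M (\<xi> n) \<eta>" if "\<eta> \<in> V (Z n)" for n \<eta>
    using max that unfolding maximizer_def by blast
  have unit: "corr (\<xi> n) t * ip M (\<xi> n) (\<xi> n) = corr (\<xi> n) t" if "t \<in> {a..b}" for n t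
    using max that unfolding maximizer_def by blast
  have energy_less: "energy (\<xi> j) (\<xi> n) = 0" if "j < n" for j n
  proof -
    \<comment> \<open>A later choice satisfies the constraints of every earlier stage, so the
      first-order condition at stage \<open>j\<close> applies to it.\<close>
    have "\<xi> n \<in> V (Z j)" using \<xi>V[of n] that unfolding V_def Z_eq by fastforce
    then show ?thesis using energy_eq_V orth[of n j] that by simp
  qed
  have energy_orth: "energy (\<xi> j) (\<xi> n) = 0" if "j \<noteq> n" for j n
    using that energy_less[of j n] energy_less[of n j] energy_commute[of "\<xi> n" "\<xi> j"]
    by (cases "j < n") auto
  \<comment> \<open>No division by norms is needed: by \<open>unit\<close>, \<xi> k has norm 1
    wherever its coefficient is nonzero. Hence \<open>sq t n\<close> is the squared norm of
    \<open>p t n\<close>.\<close>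
  define p where "p t n = (\<lambda>\<omega>. \<Sum>k<n. \<xi> k \<omega> * corr (\<xi> k) t)" for t and n :: nat
  define sq where "sq t n = (\<Sum>k<n. (corr (\<xi> k) t)\<^sup>2)" for t and n :: nat
  have pL2: "p t n \<in> L2 M" for t n unfolding p_def by (intro L2_sum L2_scale_right \<xi>L2)
  have ip_p: "ip M (p t n) h = (\<Sum>k<n. corr (\<xi> k) t * ip M (\<xi> k) h)" if "h \<in> L2 M" for t n h
    unfolding p_def using that
    by (simp add: ip_sum_left L2_scale_right \<xi>L2 mult.commute[of _ "corr _ _"] ip_scale_left L2_scale)
  have ip_p\<xi>: "ip M (p t n) (\<xi> k) = corr (\<xi> k) t" if "k < n" "t \<in> {a..b}" for t n k
  proof -
    have "ip M (p t n) (\<xi> k) = (\<Sum>j<n. if j = k then corr (\<xi> k) t * ip M (\<xi> k) (\<xi> k) else 0)"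
      unfolding ip_p[OF \<xi>L2] by (rule sum.cong) (auto simp: orth)
    then show ?thesis using that by (simp add: unit)
  qed
  have ip_pp: "ip M (p t m) (p t n) = sq t m" if "m \<le> n" "t \<in> {a..b}" for t m n
    unfolding ip_p[OF pL2] sq_def
    by (rule sum.cong) (use that in \<open>auto simp: ip_commute[of M "\<xi> _" "p t n"] ip_p\<xi> power2_eq_square\<close>)
  have ip_py: "ip M (p t n) (y t) = sq t n" if "t \<in> {a..b}" for t n
    unfolding ip_p[OF yL2[OF that]] sq_def by (simp add: corr_def power2_eq_square)
  have Bessel: "sq t n \<le> ip M (y t) (y t)" if "t \<in> {a..b}" for t n
    using sqdist_nonneg[of M "p t n" "y t"] ip_pp[OF order_refl that] ip_py[OF that]
    by (simp add: sqdist_expand pL2 yL2[OF that])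
  obtain C where C: "0 < C" "\<And>t. t \<in> {a..b} \<Longrightarrow> ip M (y t) (y t) \<le> C"
    using variance_bounded by blast
  \<comment> \<open>Bessel's inequality integrated over [a, b].\<close>
  have "summable (\<lambda>k. energy (\<xi> k) (\<xi> k))"
  proof (rule summableI_nonneg_bounded)
    fix n
    have int: "(\<lambda>t. corr (\<xi> k) t * corr (\<xi> k) t) integrable_on {a..b}" for k
      by (rule integrable_corr_mult[OF \<xi>L2 \<xi>L2])
    have "(\<Sum>k<n. energy (\<xi> k) (\<xi> k)) = integral {a..b} (\<lambda>t. \<Sum>k<n. corr (\<xi> k) t * corr (\<xi> k) t)"
      unfolding energy_def by (rule integral_sum[symmetric]) (auto intro: int)
    also have "\<dots> \<le> integral {a..b} (\<lambda>t. C)"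
    proof (rule integral_le)
      fix t assume t: "t \<in> {a..b}"
      show "(\<Sum>k<n. corr (\<xi> k) t * corr (\<xi> k) t) \<le> C"
        using Bessel[OF t, of n] C(2)[OF t] by (simp add: sq_def power2_eq_square)
    qed (auto intro: integrable_sum int)
    finally show "(\<Sum>k<n. energy (\<xi> k) (\<xi> k)) \<le> (b - a) * C" using ab by simp
  qed (simp add: energy_nonneg \<xi>L2)
  then have energy_lim: "(\<lambda>k. energy (\<xi> k) (\<xi> k)) \<longlonglongrightarrow> 0" by (rule summable_LIMSEQ_zero)
  have conv: "(\<lambda>n. sqdist M (p t n) (y t)) \<longlonglongrightarrow> 0" if t: "t \<in> {a..b}" for t
  proof -
    have "convergent (sq t)"
      by (rule Bseq_mono_convergent, rule BseqI'[of _ "ip M (y t) (y t)"])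
         (use Bessel[OF t] in \<open>auto simp: sq_def sum_nonneg intro!: sum_mono2\<close>)
    then have cau: "Cauchy (sq t)" by (rule convergent_Cauchy)
    \<comment> \<open>The squared distance of two partial sums is the increment of the increasing
      bounded sequence \<open>sq t\<close>, so they are Cauchy.\<close>
    have sqd: "sqdist M (p t i) (p t j) = \<bar>sq t i - sq t j\<bar>" for i j
    proof -
      have *: "sqdist M (p t i) (p t j) = \<bar>sq t i - sq t j\<bar>" if "i \<le> j" for i j
      proof -
        have "sqdist M (p t i) (p t j) = sq t j - sq t i"
          using ip_pp[OF that t] ip_pp[OF order_refl t] by (simp add: sqdist_expand pL2)
        then show ?thesis using sqdist_nonneg[of M "p t i" "p t j"] by simp
      qed
      show ?thesis using *[of i j] *[of j i] sqdist_commute[of M "p t i" "p t j"]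
        by (cases "i \<le> j") (auto simp: abs_minus_commute)
    qed
    obtain g where g: "g \<in> L2 M" "(\<lambda>n. sqdist M (p t n) g) \<longlonglongrightarrow> 0"
    proof (rule L2_complete[of "p t"])
      show "\<exists>N. \<forall>i\<ge>N. \<forall>j\<ge>N. sqdist M (p t i) (p t j) < e" if "e > 0" for e
        unfolding sqd using CauchyD[OF cau that] by simp
    qed (rule pL2)
    have ev: "\<forall>\<^sub>F n in sequentially. p t n \<in> L2 M" using pL2 by simp
    define r where "r = (\<lambda>\<omega>. y t \<omega> - g \<omega>)"
    have rL2: "r \<in> L2 M" unfolding r_def by (rule L2_diff[OF yL2[OF t] g(1)])
    have r\<xi>: "ip M r (\<xi> k) = 0" for k
    proof -
      have "(\<lambda>n. ip M (p t n) (\<xi> k)) \<longlonglongrightarrow> ip M g (\<xi> k)" by (rule ip_tendsto[OF ev g(1) \<xi>L2 g(2)])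
      moreover have "(\<lambda>n. ip M (p t n) (\<xi> k)) \<longlonglongrightarrow> corr (\<xi> k) t"
        by (rule tendsto_eventually, rule eventually_sequentiallyI[of "Suc k"], rule ip_p\<xi>[OF _ t]) simp
      ultimately have "ip M g (\<xi> k) = corr (\<xi> k) t" by (rule LIMSEQ_unique)
      then show ?thesis
        by (simp add: r_def ip_diff_left[OF yL2[OF t] g(1) \<xi>L2] corr_def ip_commute[of M "y t"])
    qed
    have r1: "ip M r (\<lambda>_. 1) = 0"
    proof -
      have "(\<lambda>n. ip M (p t n) (\<lambda>_. 1)) \<longlonglongrightarrow> ip M g (\<lambda>_. 1)" by (rule ip_tendsto[OF ev g(1) L2_const g(2)])
      then have "ip M g (\<lambda>_. 1) = 0" by (simp add: ip_p[OF L2_const] \<xi>mean LIMSEQ_const_iff)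
      moreover have "ip M (y t) (\<lambda>_. 1) = 0" using mean_zero[OF t] by (simp add: ip_def)
      ultimately show ?thesis by (simp add: r_def ip_diff_left[OF yL2[OF t] g(1) L2_const])
    qed
    \<comment> \<open>The residual is admissible at every stage, so its energy is at most a null
      sequence times its squared norm.\<close>
    have "r \<in> V (Z n)" for n using rL2 r\<xi> r1 by (auto simp: V_def Z_eq)
    then have "energy r r \<le> energy (\<xi> n) (\<xi> n) * ip M r r" for n by (rule energy_le_V)
    moreover have "(\<lambda>n. energy (\<xi> n) (\<xi> n) * ip M r r) \<longlonglongrightarrow> 0"
      using tendsto_mult_right[OF energy_lim, of "ip M r r"] by simp
    ultimately have "energy r r \<le> 0" by (intro LIMSEQ_le_const) auto
    then have "corr r t = 0"
      using energy_zero_imp_corr_zero[OF rL2 _ t] energy_nonneg[OF rL2] by simp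
    then have ry: "ip M r (y t) = 0" by (simp add: corr_def)
    have rg: "ip M r g = 0"
    proof -
      have "(\<lambda>n. ip M (p t n) r) \<longlonglongrightarrow> ip M g r" by (rule ip_tendsto[OF ev g(1) rL2 g(2)])
      moreover have "ip M (p t n) r = 0" for n
        unfolding ip_p[OF rL2] using r\<xi> by (simp add: ip_commute[of M "\<xi> _"])
      ultimately have "ip M g r = 0" by (simp add: LIMSEQ_const_iff)
      then show ?thesis by (simp add: ip_commute)
    qed
    \<comment> \<open>The residual is orthogonal to both terms of which it is the difference, hence
      to itself.\<close>
    have "ip M r (\<lambda>\<omega>. y t \<omega> - g \<omega>) = 0"
      by (simp add: ip_diff_right[OF yL2[OF t] g(1) rL2] ry rg)
    then have "ip M r r = 0" by (simp add: r_def)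
    then have AE: "AE \<omega> in M. r \<omega> = 0" by (rule ip_self_zero_AE[OF rL2])
    have "sqdist M (p t n) (y t) = sqdist M (p t n) g" for n
      unfolding sqdist_def
    proof (rule integral_cong_AE)
      show "AE \<omega> in M. (p t n \<omega> - y t \<omega>)\<^sup>2 = (p t n \<omega> - g \<omega>)\<^sup>2"
        using AE by eventually_elim (simp add: r_def)
      show "(\<lambda>\<omega>. (p t n \<omega> - y t \<omega>)\<^sup>2) \<in> borel_measurable M" "(\<lambda>\<omega>. (p t n \<omega> - g \<omega>)\<^sup>2) \<in> borel_measurable M"
        by (intro borel_measurable_power borel_measurable_diff L2_measurable pL2 yL2 t g(1))+
    qed
    then show ?thesis using g(2) by simp
  qed
  have "kkl_decomposition a b M y \<xi> (\<lambda>k. corr (\<xi> k))"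
    unfolding kkl_decomposition_def
  proof (intro conjI allI ballI impI)
    show "continuous_on {a..b} (corr (\<xi> k))" for k by (rule continuous_corr[OF \<xi>L2])
    show "integral {a..b} (\<lambda>t. corr (\<xi> j) t * corr (\<xi> k) t) = 0" if "j \<noteq> k" for j k
      using energy_orth[OF that] by (simp add: energy_def)
    show "\<xi> k \<in> borel_measurable M" "integrable M (\<lambda>\<omega>. (\<xi> k \<omega>)\<^sup>2)" for k
      using \<xi>L2[of k] by (simp_all add: L2_def)
    show "uncorrelated M (\<xi> j) (\<xi> k)" if "j \<noteq> k" for j k
      using orth[of k j] that \<xi>mean[of j] L2_integrable_mult[OF \<xi>L2 \<xi>L2] L2_integrable[OF \<xi>L2]
      unfolding uncorrelated_def ip_def by simp
    fix t assume t: "t \<in> {a..b}"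
    show "(\<lambda>n. mean_square_dist M (\<lambda>\<omega>. \<Sum>k<n. \<xi> k \<omega> * corr (\<xi> k) t) (y t)) \<longlonglongrightarrow> 0"
      using mean_square_dist_tendsto_iff[of "p t" "\<lambda>_. y t" M sequentially] conv[OF t]
        L2_diff[OF pL2 yL2[OF t]]
      by (simp add: p_def)
  qed
  then show ?thesis by blast
qed

end

section \<open>Rank and active parameters\<close>

text \<open>Gaussian elimination: a nonzero entry \<open>A i j0\<close> removes one equation and one
  unknown, which preserves the strict inequality of cardinalities.\<close>

lemma homogeneous_system_nontrivial_solution:
  fixes A :: "'i \<Rightarrow> 'j \<Rightarrow> real"
  assumes "finite I" "finite J" "card I < card J"
  shows "\<exists>c. (\<exists>j\<in>J. c j \<noteq> 0) \<and> (\<forall>i\<in>I. (\<Sum>j\<in>J. c j * A i j) = 0)"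
  using assms
proof (induction I arbitrary: J A rule: finite_induct)
  case empty
  then have "J \<noteq> {}" by auto
  then show ?case by (intro exI[of _ "\<lambda>_. 1"]) auto
next
  case (insert i I)
  show ?case
  proof (cases "\<forall>j\<in>J. A i j = 0")
    case True
    obtain c where "\<exists>j\<in>J. c j \<noteq> 0" "\<forall>i\<in>I. (\<Sum>j\<in>J. c j * A i j) = 0"
      using insert.IH[of J A] insert.prems insert.hyps by auto
    then show ?thesis using True by (intro exI[of _ c]) auto
  next
    case False
    then obtain j0 where j0: "j0 \<in> J" "A i j0 \<noteq> 0" by blast
    define J' where "J' = J - {j0}"
    have "card I < card J'" using insert.prems insert.hyps j0 by (simp add: J'_def)
    moreover have "finite J'" using insert.prems by (simp add: J'_def)
    ultimately obtain c where c: "\<exists>j\<in>J'. c j \<noteq> 0"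
      "\<forall>k\<in>I. (\<Sum>j\<in>J'. c j * (A k j - A k j0 * A i j / A i j0)) = 0"
      using insert.IH[of J' "\<lambda>k j. A k j - A k j0 * A i j / A i j0"] by blast
    \<comment> \<open>Back-substitution: equation \<open>i\<close> dictates the value
      \<open>- s\<close> for the eliminated unknown \<open>j0\<close>.\<close>
    define s where "s = (\<Sum>j\<in>J'. c j * A i j) / A i j0"
    define c' where "c' = c(j0 := - s)"
    have split: "(\<Sum>j\<in>J. c' j * A k j) = (\<Sum>j\<in>J'. c j * A k j) - s * A k j0" for k
    proof -
      have "(\<Sum>j\<in>J. c' j * A k j) = c' j0 * A k j0 + (\<Sum>j\<in>J'. c' j * A k j)"
        unfolding J'_def using insert.prems j0(1) by (intro sum.remove) auto
      also have "(\<Sum>j\<in>J'. c' j * A k j) = (\<Sum>j\<in>J'. c j * A k j)"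
        by (rule sum.cong) (auto simp: c'_def J'_def)
      finally show ?thesis by (simp add: c'_def)
    qed
    have "(\<Sum>j\<in>J. c' j * A k j) = 0" if "k \<in> I" for k
    proof -
      have "0 = (\<Sum>j\<in>J'. c j * (A k j - A k j0 * A i j / A i j0))" using c(2) that by simp
      also have "\<dots> = (\<Sum>j\<in>J'. c j * A k j - (c j * A i j) * (A k j0 / A i j0))"
        by (rule sum.cong) (auto simp: field_simps)
      also have "\<dots> = (\<Sum>j\<in>J'. c j * A k j) - s * A k j0"
        by (simp add: s_def sum_subtractf sum_distrib_right sum_divide_distrib)
      finally show ?thesis using split by simp
    qed
    moreover have "(\<Sum>j\<in>J. c' j * A i j) = 0" using j0 by (simp add: split s_def)
    moreover have "\<exists>j\<in>J. c' j \<noteq> 0" using c(1) by (auto simp: c'_def J'_def)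
    ultimately show ?thesis by (intro exI[of _ c']) auto
  qed
qed

section \<open>Finite rank and finitely many active parameters\<close>

lemma kkl_decomposition_L2: "kkl_decomposition a b M y \<theta> e \<Longrightarrow> \<theta> k \<in> L2 M"
  by (simp add: kkl_decomposition_def L2_def)

lemma kkl_decomposition_tendsto:
  assumes kkl: "kkl_decomposition a b M y \<theta> e" and t: "t \<in> {a..b}" and y: "y t \<in> L2 M"
  shows "(\<lambda>\<omega>. \<Sum>k<n. \<theta> k \<omega> * e k t) \<in> L2 M"
    and "(\<lambda>n. sqdist M (\<lambda>\<omega>. \<Sum>k<n. \<theta> k \<omega> * e k t) (y t)) \<longlonglongrightarrow> 0"
proof -
  have L: "(\<lambda>\<omega>. \<Sum>k<n. \<theta> k \<omega> * e k t) \<in> L2 M" for n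
    by (intro L2_sum L2_scale_right kkl_decomposition_L2[OF kkl])
  then show "(\<lambda>\<omega>. \<Sum>k<n. \<theta> k \<omega> * e k t) \<in> L2 M" .
  have "\<forall>\<^sub>F n in sequentially. (\<lambda>\<omega>. (\<Sum>k<n. \<theta> k \<omega> * e k t) - y t \<omega>) \<in> L2 M"
    using L2_diff[OF L y] by simp
  from mean_square_dist_tendsto_iff[OF this]
  show "(\<lambda>n. sqdist M (\<lambda>\<omega>. \<Sum>k<n. \<theta> k \<omega> * e k t) (y t)) \<longlonglongrightarrow> 0"
    using kkl t unfolding kkl_decomposition_def by blast
qed

context prob_space begin

lemma sqdist_const:
  assumes "z \<in> L2 M"
  shows "sqdist M z (\<lambda>_. d) = ip M z z - 2 * d * expectation z + d\<^sup>2"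
proof -
  have "ip M z (\<lambda>_. d) = d * expectation z"
    unfolding ip_def by (simp add: mult.commute)
  moreover have "ip M (\<lambda>_. d) (\<lambda>_. d) = d\<^sup>2"
    by (simp add: ip_def prob_space power2_eq_square)
  ultimately show ?thesis by (simp add: sqdist_expand[OF assms L2_const])
qed

text \<open>The two sides differ by the square of \<open>d - expectation z\<close>: the mean is the
  best constant approximation.\<close>

lemma sqdist_expectation_le: "z \<in> L2 M \<Longrightarrow> sqdist M z (\<lambda>_. expectation z) \<le> sqdist M z (\<lambda>_. d)"
  using zero_le_power2[of "d - expectation z"]
  by (simp add: sqdist_const power2_eq_square algebra_simps)

text \<open>At each time the inactive terms are almost surely constant, so \<open>y t\<close> minus
  the finite active sum is a mean-square limit of constants and thus itself constant. The constant
  need not vanish termwise, as the definition does not ask the \<open>\<theta> k\<close> to be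
  centered.\<close>

lemma finite_active_params_imp_finite_rank:
  assumes kkl: "kkl_decomposition a b M y \<theta> e"
    and y: "\<And>t. t \<in> {a..b} \<Longrightarrow> y t \<in> L2 M"
    and fin: "finite (active_params {a..b} M \<theta> e)"
  shows "finite_rank_process {a..b} M y"
proof -
  define A where "A = active_params {a..b} M \<theta> e"
  note \<theta>L2 = kkl_decomposition_L2[OF kkl]
  define F where "F t = (\<lambda>\<omega>. \<Sum>k\<in>A. \<theta> k \<omega> * e k t)" for t
  define z where "z t = (\<lambda>\<omega>. y t \<omega> - F t \<omega>)" for t
  have FL2: "F t \<in> L2 M" for t unfolding F_def by (intro L2_sum L2_scale_right \<theta>L2)
  have zL2: "z t \<in> L2 M" if "t \<in> {a..b}" for t unfolding z_def by (rule L2_diff[OF y[OF that] FL2])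
  have inactive: "AE \<omega> in M. \<theta> k \<omega> * e k t = expectation (\<theta> k) * e k t" if "k \<notin> A" "t \<in> {a..b}" for k t
  proof (cases "e k t = 0")
    case False
    with that have "\<exists>c. AE \<omega> in M. \<theta> k \<omega> = c"
      unfolding A_def active_params_def mem_Collect_eq by metis
    then obtain c where c: "AE \<omega> in M. \<theta> k \<omega> = c" ..
    have "expectation (\<theta> k) = expectation (\<lambda>_. c)"
      by (rule integral_cong_AE[OF L2_measurable[OF \<theta>L2] borel_measurable_const c])
    then have "expectation (\<theta> k) = c" by (simp add: prob_space)
    with c show ?thesis by (simp add: eventually_mono)
  qed simp
  have z_const: "AE \<omega> in M. z t \<omega> = expectation (z t)" if t: "t \<in> {a..b}" for t
  proof -
    define D where "D n = (\<Sum>k\<in>{..<n} - A. expectation (\<theta> k) * e k t)" for n :: nat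
    obtain N where N: "\<And>k. k \<in> A \<Longrightarrow> k < N"
      using fin unfolding A_def[symmetric] by (metis finite_nat_set_iff_bounded)
    \<comment> \<open>Comparing with the best constant avoids showing that the constants
      \<open>D n\<close> converge.\<close>
    have "sqdist M (z t) (\<lambda>_. expectation (z t)) \<le> sqdist M (\<lambda>\<omega>. \<Sum>k<n. \<theta> k \<omega> * e k t) (y t)" if n: "n \<ge> N" for n
    proof -
      have sub: "A \<subseteq> {..<n}" using N n by fastforce
      have "AE \<omega> in M. \<forall>k\<in>{..<n} - A. \<theta> k \<omega> * e k t = expectation (\<theta> k) * e k t"
        by (rule AE_finite_allI) (use inactive t in auto)
      then have "AE \<omega> in M. ((\<Sum>k<n. \<theta> k \<omega> * e k t) - y t \<omega>)\<^sup>2 = (z t \<omega> - D n)\<^sup>2"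
      proof eventually_elim
        case (elim \<omega>)
        have "(\<Sum>k<n. \<theta> k \<omega> * e k t) = (\<Sum>k\<in>{..<n} - A. \<theta> k \<omega> * e k t) + F t \<omega>"
          unfolding F_def by (rule sum.subset_diff[OF sub]) simp
        also have "(\<Sum>k\<in>{..<n} - A. \<theta> k \<omega> * e k t) = D n"
          unfolding D_def by (rule sum.cong) (use elim in auto)
        finally have "(\<Sum>k<n. \<theta> k \<omega> * e k t) - y t \<omega> = - (z t \<omega> - D n)" by (simp add: z_def)
        then show ?case by (simp only: power2_minus)
      qed
      then have "sqdist M (\<lambda>\<omega>. \<Sum>k<n. \<theta> k \<omega> * e k t) (y t) = sqdist M (z t) (\<lambda>_. D n)"
        unfolding sqdist_def
        by (rule integral_cong_AE[rotated 2])
          (intro borel_measurable_power borel_measurable_diff borel_measurable_const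
             L2_measurable zL2 t y kkl_decomposition_tendsto(1)[OF kkl t y[OF t]])+
      then show ?thesis using sqdist_expectation_le[OF zL2[OF t], of "D n"] by simp
    qed
    then have "sqdist M (z t) (\<lambda>_. expectation (z t)) \<le> 0"
      by (intro LIMSEQ_le_const[OF kkl_decomposition_tendsto(2)[OF kkl t y[OF t]]]) blast
    then have "ip M (\<lambda>\<omega>. z t \<omega> - expectation (z t)) (\<lambda>\<omega>. z t \<omega> - expectation (z t)) = 0"
      using sqdist_nonneg[of M "z t" "\<lambda>_. expectation (z t)"] by (simp add: sqdist_eq_ip)
    from ip_self_zero_AE[OF L2_diff[OF zL2[OF t] L2_const] this] show ?thesis by simp
  qed
  obtain h where h: "bij_betw h {0..<card A} A"
    using ex_bij_betw_nat_finite[OF fin[folded A_def]] by blast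
  define N where "N = card A"
  \<comment> \<open>One extra rank-one term, at index \<open>N\<close>, carries the deterministic
    remainder.\<close>
  define \<xi> where "\<xi> i = (if i < N then \<theta> (h i) else (\<lambda>_. 1))" for i
  define f where "f i t = (if i < N then e (h i) t else expectation (z t))" for i t
  have "\<xi> i \<in> borel_measurable M" for i
    unfolding \<xi>_def using L2_measurable[OF \<theta>L2] by auto
  moreover have "AE \<omega> in M. y t \<omega> = (\<Sum>i<Suc N. \<xi> i \<omega> * f i t)" if t: "t \<in> {a..b}" for t
    using z_const[OF t]
  proof eventually_elim
    case (elim \<omega>)
    have "(\<Sum>i<N. \<xi> i \<omega> * f i t) = (\<Sum>i\<in>{0..<N}. \<theta> (h i) \<omega> * e (h i) t)"
      by (rule sum.cong) (auto simp: \<xi>_def f_def)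
    also have "\<dots> = F t \<omega>"
      unfolding F_def N_def by (rule sum.reindex_bij_betw[OF h])
    finally have "(\<Sum>i<Suc N. \<xi> i \<omega> * f i t) = F t \<omega> + expectation (z t)"
      by (simp add: \<xi>_def f_def)
    then show ?case using elim by (simp add: z_def)
  qed
  ultimately show ?thesis unfolding finite_rank_process_def by blast
qed

text \<open>Uncorrelated means orthogonal after centering, so pairing with
  \<open>\<theta>' k\<close> keeps only the \<open>k\<close>-th term and is constant along the
  partial sums beyond \<open>k\<close>.\<close>

lemma kkl_decomposition_projection:
  assumes kkl: "kkl_decomposition a b M y \<theta> e" and t: "t \<in> {a..b}" and y: "y t \<in> L2 M"
  defines "\<theta>' \<equiv> \<lambda>k \<omega>. \<theta> k \<omega> - expectation (\<theta> k)"
  shows "ip M (y t) (\<theta>' k) = ip M (\<theta>' k) (\<theta>' k) * e k t"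
proof -
  note \<theta>L2 = kkl_decomposition_L2[OF kkl]
  have \<theta>'L2: "\<theta>' k \<in> L2 M" unfolding \<theta>'_def by (rule L2_diff[OF \<theta>L2 L2_const])
  have cov: "ip M (\<theta> j) (\<theta>' k) = ip M (\<theta> j) (\<theta> k) - expectation (\<theta> j) * expectation (\<theta> k)" for j
    unfolding \<theta>'_def by (subst ip_diff_right[OF \<theta>L2 L2_const \<theta>L2]) (simp add: ip_def)
  have m0: "ip M (\<lambda>_. c) (\<theta>' k) = 0" for c
    using L2_integrable[OF \<theta>L2] by (simp add: ip_def \<theta>'_def prob_space)
  have diag: "ip M (\<theta> k) (\<theta>' k) = ip M (\<theta>' k) (\<theta>' k)"
  proof -
    have "ip M (\<lambda>\<omega>. \<theta> k \<omega> - expectation (\<theta> k)) (\<theta>' k) = ip M (\<theta> k) (\<theta>' k)"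
      using ip_diff_left[OF \<theta>L2 L2_const \<theta>'L2, of k "expectation (\<theta> k)"] m0 by simp
    then show ?thesis by (simp add: \<theta>'_def)
  qed
  have off: "ip M (\<theta> j) (\<theta>' k) = 0" if "j \<noteq> k" for j
  proof -
    have "uncorrelated M (\<theta> j) (\<theta> k)" using kkl that unfolding kkl_decomposition_def by blast
    then show ?thesis unfolding cov by (simp add: uncorrelated_def ip_def)
  qed
  have "(\<lambda>n. ip M (\<lambda>\<omega>. \<Sum>j<n. \<theta> j \<omega> * e j t) (\<theta>' k)) \<longlonglongrightarrow> ip M (y t) (\<theta>' k)"
    by (rule ip_tendsto[OF _ y \<theta>'L2 kkl_decomposition_tendsto(2)[OF kkl t y]])
       (simp add: kkl_decomposition_tendsto(1)[OF kkl t y])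
  moreover have "(\<lambda>n. ip M (\<lambda>\<omega>. \<Sum>j<n. \<theta> j \<omega> * e j t) (\<theta>' k)) \<longlonglongrightarrow> ip M (\<theta>' k) (\<theta>' k) * e k t"
  proof (rule tendsto_eventually, rule eventually_sequentiallyI[of "Suc k"])
    fix n assume "Suc k \<le> n"
    have "ip M (\<lambda>\<omega>. \<Sum>j<n. \<theta> j \<omega> * e j t) (\<theta>' k) = (\<Sum>j<n. e j t * ip M (\<theta> j) (\<theta>' k))"
      by (subst ip_sum_left) (auto simp: \<theta>'L2 L2_scale_right \<theta>L2 mult.commute[of _ "e _ t"] ip_scale_left L2_scale)
    also have "\<dots> = (\<Sum>j<n. if j = k then e k t * ip M (\<theta>' k) (\<theta>' k) else 0)"
      by (rule sum.cong) (auto simp: off diag)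
    finally show "ip M (\<lambda>\<omega>. \<Sum>j<n. \<theta> j \<omega> * e j t) (\<theta>' k) = ip M (\<theta>' k) (\<theta>' k) * e k t"
      using \<open>Suc k \<le> n\<close> by (simp add: mult.commute)
  qed
  ultimately show ?thesis by (rule LIMSEQ_unique)
qed

text \<open>Finite rank makes all \<open>y t\<close> combinations of finitely many \<open>y (\<tau> j)\<close>, and projecting on
  \<open>\<theta> k\<close> transfers these relations to \<open>e k\<close> for every active \<open>k\<close> at once. So the active
  \<open>e k\<close>, which are orthogonal and nonzero, span a finite-dimensional space. The variables in
  \<open>finite_rank_process\<close> need not be integrable, hence the detour over the \<open>y (\<tau> j)\<close>.\<close>

lemma finite_rank_imp_finite_active_params:
  assumes ab: "a < b" and kkl: "kkl_decomposition a b M y \<theta> e"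
    and y: "\<And>t. t \<in> {a..b} \<Longrightarrow> y t \<in> L2 M"
    and rank: "finite_rank_process {a..b} M y"
  shows "finite (active_params {a..b} M \<theta> e)"
proof (rule ccontr)
  assume inf: "infinite (active_params {a..b} M \<theta> e)"
  obtain n :: nat and \<xi> f where \<xi>f: "\<And>t. t \<in> {a..b} \<Longrightarrow> AE \<omega> in M. y t \<omega> = (\<Sum>i<n. \<xi> i \<omega> * f i t)"
    using rank unfolding finite_rank_process_def by blast
  \<comment> \<open>Linear independence of the variables \<open>y (\<tau> j)\<close> modulo null
    sets. Its size is bounded by the rank, so a maximal \<open>m\<close> exists.\<close>
  define indep where "indep m \<tau> \<longleftrightarrow> (\<forall>j<m. \<tau> j \<in> {a..b}) \<and>
      (\<forall>c. (AE \<omega> in M. (\<Sum>j<m. c j * y (\<tau> j) \<omega>) = 0) \<longrightarrow> (\<forall>j<m. c j = (0::real)))"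
    for m :: nat and \<tau> :: "nat \<Rightarrow> real"
  have indep_le: "m \<le> n" if "indep m \<tau>" for m \<tau>
  proof (rule ccontr)
    assume "\<not> m \<le> n"
    then obtain c where c: "\<exists>j\<in>{..<m}. c j \<noteq> 0" "\<forall>i\<in>{..<n}. (\<Sum>j<m. c j * f i (\<tau> j)) = 0"
      using homogeneous_system_nontrivial_solution[of "{..<n}" "{..<m}" "\<lambda>i j. f i (\<tau> j)"] by auto
    have "AE \<omega> in M. \<forall>j\<in>{..<m}. y (\<tau> j) \<omega> = (\<Sum>i<n. \<xi> i \<omega> * f i (\<tau> j))"
      by (rule AE_finite_allI) (use that \<xi>f in \<open>auto simp: indep_def\<close>)
    then have "AE \<omega> in M. (\<Sum>j<m. c j * y (\<tau> j) \<omega>) = 0"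
    proof eventually_elim
      case (elim \<omega>)
      have "(\<Sum>j<m. c j * y (\<tau> j) \<omega>) = (\<Sum>j<m. \<Sum>i<n. \<xi> i \<omega> * (c j * f i (\<tau> j)))"
        using elim by (intro sum.cong) (auto simp: sum_distrib_left mult.left_commute)
      also have "\<dots> = (\<Sum>i<n. \<xi> i \<omega> * (\<Sum>j<m. c j * f i (\<tau> j)))"
        by (subst sum.swap) (simp add: sum_distrib_left)
      also have "\<dots> = 0" using c(2) by simp
      finally show ?case .
    qed
    then show False using that c(1) unfolding indep_def by blast
  qed
  have "\<exists>\<tau>. indep 0 \<tau>" by (simp add: indep_def)
  moreover have "\<forall>k. (\<exists>\<tau>. indep k \<tau>) \<longrightarrow> k < Suc n" using indep_le by (auto simp: less_Suc_eq_le)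
  ultimately have "\<exists>m. (\<exists>\<tau>. indep m \<tau>) \<and> (\<forall>k. (\<exists>\<tau>. indep k \<tau>) \<longrightarrow> k \<le> m)"
    by (rule ex_has_greatest_nat)
  then obtain m where m: "\<exists>\<tau>. indep m \<tau>" "\<And>k. (\<exists>\<tau>. indep k \<tau>) \<Longrightarrow> k \<le> m" by blast
  obtain \<tau> where \<tau>: "indep m \<tau>" using m(1) by blast
  then have \<tau>S: "\<tau> j \<in> {a..b}" if "j < m" for j using that unfolding indep_def by blast
  define \<theta>' where "\<theta>' k = (\<lambda>\<omega>. \<theta> k \<omega> - expectation (\<theta> k))" for k
  note \<theta>L2 = kkl_decomposition_L2[OF kkl]
  have \<theta>'L2: "\<theta>' k \<in> L2 M" for k unfolding \<theta>'_def by (rule L2_diff[OF \<theta>L2 L2_const])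
  have proj: "ip M (y t) (\<theta>' k) = ip M (\<theta>' k) (\<theta>' k) * e k t" if "t \<in> {a..b}" for t k
    using kkl_decomposition_projection[OF kkl that y[OF that]] by (simp add: \<theta>'_def)
  have var_pos: "ip M (\<theta>' k) (\<theta>' k) \<noteq> 0" if "k \<in> active_params {a..b} M \<theta> e" for k
  proof
    assume "ip M (\<theta>' k) (\<theta>' k) = 0"
    then have "AE \<omega> in M. \<theta> k \<omega> = expectation (\<theta> k)"
      using ip_self_zero_AE[OF \<theta>'L2] by (auto simp: \<theta>'_def)
    then show False using that unfolding active_params_def by blast
  qed
  obtain K where K: "finite K" "card K = Suc m" "K \<subseteq> active_params {a..b} M \<theta> e"
    using infinite_arbitrarily_large[OF inf] by blast
  \<comment> \<open>More active indices than sample times: some nontrivial combination of the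
    \<open>e k\<close> vanishes at all \<tau> j, and maximality of \<open>m\<close> will spread this
    to every \<open>t\<close>.\<close>
  obtain d where d: "\<exists>k\<in>K. d k \<noteq> 0" "\<forall>j\<in>{..<m}. (\<Sum>k\<in>K. d k * e k (\<tau> j)) = 0"
    using homogeneous_system_nontrivial_solution[of "{..<m}" K "\<lambda>j k. e k (\<tau> j)"] K by auto
  have zero: "(\<Sum>k\<in>K. d k * e k t) = 0" if t: "t \<in> {a..b}" for t
  proof -
    have "\<not> indep (Suc m) (\<tau>(m := t))" using m(2)[of "Suc m"] by auto
    moreover have "\<forall>j<Suc m. (\<tau>(m := t)) j \<in> {a..b}" using \<tau>S t by (auto simp: less_Suc_eq)
    ultimately obtain c j where c0: "AE \<omega> in M. (\<Sum>j<Suc m. c j * y ((\<tau>(m := t)) j) \<omega>) = 0"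
      and j: "j < Suc m" "c j \<noteq> 0" unfolding indep_def by blast
    have "(\<Sum>j<m. c j * y ((\<tau>(m := t)) j) \<omega>) = (\<Sum>j<m. c j * y (\<tau> j) \<omega>)" for \<omega>
      by (rule sum.cong) auto
    with c0 have c: "AE \<omega> in M. (\<Sum>j<m. c j * y (\<tau> j) \<omega>) + c m * y t \<omega> = 0" by simp
    have cm: "c m \<noteq> 0"
    proof
      assume "c m = 0"
      with c have "AE \<omega> in M. (\<Sum>j<m. c j * y (\<tau> j) \<omega>) = 0" by simp
      then have "\<forall>j<m. c j = 0" using \<tau> unfolding indep_def by blast
      with \<open>c m = 0\<close> j show False by (auto simp: less_Suc_eq)
    qed
    \<comment> \<open>Projection on \<open>\<theta>' k\<close> turns the relation between variables
      into one between values of \<open>e k\<close>, multiplied by a variance that is nonzero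
      because \<open>k\<close> is active.\<close>
    have rel: "(\<Sum>j<m. c j * e k (\<tau> j)) + c m * e k t = 0" if k: "k \<in> K" for k
    proof -
      let ?v = "ip M (\<theta>' k) (\<theta>' k)"
      have L: "(\<lambda>\<omega>. c j * y (\<tau> j) \<omega>) \<in> L2 M" if "j < m" for j by (intro L2_scale y \<tau>S that)
      have Ls: "(\<lambda>\<omega>. \<Sum>j<m. c j * y (\<tau> j) \<omega>) \<in> L2 M" by (intro L2_sum L) simp
      have Lt: "(\<lambda>\<omega>. c m * y t \<omega>) \<in> L2 M" by (intro L2_scale y t)
      have "0 = ip M (\<lambda>\<omega>. (\<Sum>j<m. c j * y (\<tau> j) \<omega>) + c m * y t \<omega>) (\<theta>' k)"
        using ip_cong_AE[OF c L2_measurable[OF L2_add[OF Ls Lt]] borel_measurable_const L2_measurable[OF \<theta>'L2]]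
        by (simp add: ip_def)
      also have "\<dots> = (\<Sum>j<m. c j * ip M (y (\<tau> j)) (\<theta>' k)) + c m * ip M (y t) (\<theta>' k)"
        using ip_add_left[OF Ls Lt \<theta>'L2] ip_sum_left[OF L \<theta>'L2, of "{..<m}"] by (simp add: ip_scale_left)
      also have "\<dots> = ?v * ((\<Sum>j<m. c j * e k (\<tau> j)) + c m * e k t)"
        unfolding distrib_left sum_distrib_left proj[OF t]
        by (intro arg_cong2[where f = "(+)"] sum.cong) (auto simp: proj[OF \<tau>S])
      finally show ?thesis using var_pos k K(3) by auto
    qed
    have "c m * (\<Sum>k\<in>K. d k * e k t) = (\<Sum>k\<in>K. d k * (c m * e k t))"
      by (simp add: sum_distrib_left mult.left_commute)
    also have "\<dots> = (\<Sum>k\<in>K. d k * - (\<Sum>j<m. c j * e k (\<tau> j)))"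
      using rel by (intro sum.cong) (auto simp: add_eq_0_iff)
    also have "\<dots> = - (\<Sum>k\<in>K. \<Sum>j<m. c j * (d k * e k (\<tau> j)))"
      by (simp add: sum_distrib_left sum_negf mult.left_commute)
    also have "\<dots> = - (\<Sum>j<m. c j * (\<Sum>k\<in>K. d k * e k (\<tau> j)))"
      by (subst sum.swap) (simp add: sum_distrib_left)
    also have "\<dots> = 0" using d(2) by simp
    finally show ?thesis using cm by simp
  qed
  obtain k0 where k0: "k0 \<in> K" "d k0 \<noteq> 0" using d(1) by blast
  have ce: "continuous_on {a..b} (e k)" for k using kkl unfolding kkl_decomposition_def by blast
  have orth: "integral {a..b} (\<lambda>t. e j t * e k t) = 0" if "j \<noteq> k" for j k
    using kkl that unfolding kkl_decomposition_def by blast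
  have int: "(\<lambda>t. d k * (e k t * e k0 t)) integrable_on {a..b}" for k
    by (intro integrable_continuous_real continuous_on_mult continuous_on_const ce)
  \<comment> \<open>Pairing the vanishing combination with \<open>e k0\<close> isolates the norm of
    \<open>e k0\<close>, which is nonzero by continuity.\<close>
  have "0 = integral {a..b} (\<lambda>t. \<Sum>k\<in>K. d k * (e k t * e k0 t))"
  proof -
    have "integral {a..b} (\<lambda>t. \<Sum>k\<in>K. d k * (e k t * e k0 t)) = integral {a..b} (\<lambda>t. 0)"
    proof (rule integral_cong)
      fix t assume "t \<in> {a..b}"
      have "(\<Sum>k\<in>K. d k * (e k t * e k0 t)) = (\<Sum>k\<in>K. d k * e k t) * e k0 t"
        by (simp add: sum_distrib_right mult.assoc)
      then show "(\<Sum>k\<in>K. d k * (e k t * e k0 t)) = 0" using zero[OF \<open>t \<in> {a..b}\<close>] by simp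
    qed
    then show ?thesis by simp
  qed
  also have "\<dots> = (\<Sum>k\<in>K. integral {a..b} (\<lambda>t. d k * (e k t * e k0 t)))"
    by (rule integral_sum[OF K(1) int])
  also have "\<dots> = (\<Sum>k\<in>K. if k = k0 then d k0 * integral {a..b} (\<lambda>t. e k0 t * e k0 t) else 0)"
    by (rule sum.cong) (auto simp: orth)
  also have "\<dots> = d k0 * integral {a..b} (\<lambda>t. e k0 t * e k0 t)"
    using K(1) k0(1) by simp
  finally have "integral {a..b} (\<lambda>t. e k0 t * e k0 t) = 0" using k0(2) by simp
  then have "\<forall>t\<in>{a..b}. e k0 t * e k0 t = 0"
    by (intro integral_eq_0_iff[THEN iffD1] continuous_on_mult ce) (use ab in auto)
  then show False using k0(1) K(3) unfolding active_params_def by auto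
qed

end

section \<open>Network representations\<close>

lemma measurable_param_restrict:
  assumes "\<And>i. i \<in> I \<Longrightarrow> \<theta> i \<in> borel_measurable M"
  shows "(\<lambda>\<omega>. \<lambda>i\<in>I. \<theta> i \<omega>) \<in> M \<rightarrow>\<^sub>M (\<Pi>\<^sub>M i\<in>I. borel)"
  using assms by (rule measurable_restrict)

lemma neural_network_param_law:
  assumes "prob_space M" "\<And>i. i \<in> I \<Longrightarrow> \<theta> i \<in> borel_measurable M"
    and "\<And>t. t \<in> T \<Longrightarrow> (\<lambda>p. \<phi> p t) \<in> borel_measurable (\<Pi>\<^sub>M i\<in>I. borel)"
  shows "neural_network T I (param_law M I \<theta>) \<phi>"
  using assms prob_space.prob_space_distr[OF assms(1) measurable_param_restrict[OF assms(2)]]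
  by (simp add: neural_network_def param_law_def)

lemma nn_represents_measurable:
  assumes "nn_represents T M x I \<theta> \<phi>" "t \<in> T"
  shows "(\<lambda>p. \<phi> p t) \<in> borel_measurable (\<Pi>\<^sub>M i\<in>I. borel)"
  using assms by (simp add: nn_represents_def neural_network_def param_law_def)

text \<open>Networks are built with parameters indexed by naturals, whereas \<open>NNQM\<close>
  prescribes an index type; an injection relabels the parameters by its range.\<close>

lemma nn_represents_reindex:
  fixes \<theta> :: "'k \<Rightarrow> 'w \<Rightarrow> real" and g :: "'k \<Rightarrow> 'i"
  assumes M: "prob_space M" and rep: "nn_represents T M x UNIV \<theta> \<phi>" and g: "inj g"
  shows "nn_represents T M x (range g) (\<lambda>i. \<theta> (inv g i)) (\<lambda>p. \<phi> (\<lambda>k. p (g k)))"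
  unfolding nn_represents_def
proof (intro conjI ballI)
  have \<theta>: "\<theta> k \<in> borel_measurable M" for k using rep by (simp add: nn_represents_def)
  then show "\<theta> (inv g i) \<in> borel_measurable M" for i .
  show "neural_network T (range g) (param_law M (range g) (\<lambda>i. \<theta> (inv g i))) (\<lambda>p. \<phi> (\<lambda>k. p (g k)))"
  proof (rule neural_network_param_law[OF M])
    fix t assume t: "t \<in> T"
    have "(\<lambda>p. \<lambda>k\<in>UNIV. p (g k)) \<in> (\<Pi>\<^sub>M i\<in>range g. borel) \<rightarrow>\<^sub>M (\<Pi>\<^sub>M k\<in>(UNIV::'k set). (borel :: real measure))"
      by (intro measurable_restrict measurable_component_singleton) simp
    from measurable_compose[OF this nn_represents_measurable[OF rep t]]
    show "(\<lambda>p. \<phi> (\<lambda>k. p (g k)) t) \<in> borel_measurable (\<Pi>\<^sub>M i\<in>range g. borel)"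
      by (simp add: restrict_UNIV)
  qed (rule \<theta>)
  fix t assume "t \<in> T"
  then have "AE \<omega> in M. x t \<omega> = \<phi> (\<lambda>k. \<theta> k \<omega>) t" using rep by (simp add: nn_represents_def restrict_UNIV)
  then show "AE \<omega> in M. x t \<omega> = \<phi> (\<lambda>k. (\<lambda>i\<in>range g. \<theta> (inv g i) \<omega>) (g k)) t"
    using g by simp
qed

text \<open>Finitely many almost sure identities hold simultaneously, so equality at each single
  time already determines the finite-dimensional laws.\<close>

lemma nn_represents_joint_law:
  assumes x: "\<And>t. t \<in> T \<Longrightarrow> x t \<in> borel_measurable M"
    and rep: "nn_represents T M x I \<theta> \<phi>" and J: "finite J" "J \<subseteq> T"
  shows "joint_law (param_law M I \<theta>) (\<lambda>t p. \<phi> p t) J = joint_law M x J"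
proof -
  let ?\<Theta> = "\<lambda>\<omega>. \<lambda>i\<in>I. \<theta> i \<omega>"
  have \<Theta>: "?\<Theta> \<in> M \<rightarrow>\<^sub>M (\<Pi>\<^sub>M i\<in>I. borel)"
    using rep by (intro measurable_param_restrict) (simp add: nn_represents_def)
  have \<phi>: "(\<lambda>p. \<lambda>t\<in>J. \<phi> p t) \<in> (\<Pi>\<^sub>M i\<in>I. borel) \<rightarrow>\<^sub>M (\<Pi>\<^sub>M t\<in>J. borel)"
    using nn_represents_measurable[OF rep] J by (intro measurable_restrict) blast
  have "joint_law (param_law M I \<theta>) (\<lambda>t p. \<phi> p t) J =
      distr M (\<Pi>\<^sub>M t\<in>J. borel) ((\<lambda>p. \<lambda>t\<in>J. \<phi> p t) \<circ> ?\<Theta>)"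
    unfolding joint_law_def param_law_def by (rule distr_distr[OF \<phi> \<Theta>])
  also have "\<dots> = distr M (\<Pi>\<^sub>M t\<in>J. borel) (\<lambda>\<omega>. \<lambda>t\<in>J. x t \<omega>)"
  proof (rule distr_cong_AE[OF refl refl])
    have "AE \<omega> in M. \<forall>t\<in>J. x t \<omega> = \<phi> (?\<Theta> \<omega>) t"
      using rep J by (intro AE_finite_allI) (auto simp: nn_represents_def)
    then show "AE \<omega> in M. ((\<lambda>p. \<lambda>t\<in>J. \<phi> p t) \<circ> ?\<Theta>) \<omega> = (\<lambda>t\<in>J. x t \<omega>)"
      by eventually_elim (auto simp: fun_eq_iff restrict_def)
    show "(\<lambda>p. \<lambda>t\<in>J. \<phi> p t) \<circ> ?\<Theta> \<in> M \<rightarrow>\<^sub>M (\<Pi>\<^sub>M t\<in>J. borel)" by (rule measurable_comp[OF \<Theta> \<phi>])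
    show "(\<lambda>\<omega>. \<lambda>t\<in>J. x t \<omega>) \<in> M \<rightarrow>\<^sub>M (\<Pi>\<^sub>M t\<in>J. borel)"
      using x J by (intro measurable_restrict) blast
  qed
  finally show ?thesis by (simp add: joint_law_def)
qed

section \<open>Networks from samples and from the series\<close>

context prob_space begin

text \<open>The index sequence \<open>j t\<close> is chosen once for each time, independently of the
  outcome; so the network is a pointwise limit of coordinates and therefore measurable.\<close>

lemma nn_represents_dense_samples:
  fixes x :: "real \<Rightarrow> 'a \<Rightarrow> real"
  assumes ne: "T \<noteq> {}" and x: "\<And>t. t \<in> T \<Longrightarrow> x t \<in> L2 M"
    and ms: "\<And>t. t \<in> T \<Longrightarrow> ((\<lambda>s. sqdist M (x s) (x t)) \<longlongrightarrow> 0) (at t within T)"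
  shows "\<exists>(\<theta> :: nat \<Rightarrow> 'a \<Rightarrow> real) \<phi>. nn_represents T M x UNIV \<theta> \<phi>"
proof -
  obtain D where D: "countable D" "D \<subseteq> T" "T \<subseteq> closure D" using separable by blast
  have "D \<noteq> {}" using D(3) ne by auto
  define d where "d = from_nat_into D"
  have d: "range d = D" unfolding d_def by (rule range_from_nat_into[OF \<open>D \<noteq> {}\<close> D(1)])
  have dT: "d k \<in> T" for k using d D(2) by blast
  have "\<exists>j. AE \<omega> in M. (\<lambda>n. x (d (j n)) \<omega>) \<longlonglongrightarrow> x t \<omega>" if t: "t \<in> T" for t
  proof -
    obtain u where u: "\<And>n. u n \<in> D" "u \<longlonglongrightarrow> t"
      using t D(3) closure_sequential[of t D] by blast
    then have "\<forall>n. \<exists>k. u n = d k" using d by (metis rangeE)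
    then obtain i where i: "\<And>n. u n = d (i n)" by metis
    \<comment> \<open>The approximating times may coincide with \<open>t\<close>, so continuity is
      used instead of the punctured limit.\<close>
    have "continuous (at t within T) (\<lambda>s. sqdist M (x s) (x t))"
      unfolding continuous_within using ms[OF t] by (simp add: sqdist_def)
    then have "((\<lambda>s. sqdist M (x s) (x t)) \<circ> u) \<longlonglongrightarrow> sqdist M (x t) (x t)"
      using u D(2) unfolding continuous_within_sequentially by blast
    then have "(\<lambda>n. sqdist M (x (d (i n))) (x t)) \<longlonglongrightarrow> 0" by (simp add: o_def i) (simp add: sqdist_def)
    then obtain r :: "nat \<Rightarrow> nat" where "AE \<omega> in M. (\<lambda>n. x (d (i (r n))) \<omega>) \<longlonglongrightarrow> x t \<omega>"
      using L2_tendsto_AE_subseq[of "\<lambda>n. x (d (i n))" "x t"] x[OF dT] x[OF t] by metis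
    then show ?thesis by (intro exI[of _ "\<lambda>n. i (r n)"])
  qed
  then obtain j where j: "\<And>t. t \<in> T \<Longrightarrow> AE \<omega> in M. (\<lambda>n. x (d (j t n)) \<omega>) \<longlonglongrightarrow> x t \<omega>" by metis
  define \<phi> where "\<phi> p t = lim (\<lambda>n. p (j t n))" for p :: "nat \<Rightarrow> real" and t
  have \<theta>: "x (d k) \<in> borel_measurable M" for k by (rule L2_measurable[OF x[OF dT]])
  have "nn_represents T M x UNIV (\<lambda>k. x (d k)) \<phi>"
    unfolding nn_represents_def
  proof (intro conjI ballI \<theta>)
    show "neural_network T UNIV (param_law M UNIV (\<lambda>k. x (d k))) \<phi>"
    proof (rule neural_network_param_law[OF prob_space_axioms \<theta>])
      fix t
      show "(\<lambda>p. \<phi> p t) \<in> borel_measurable (\<Pi>\<^sub>M i\<in>UNIV. borel)"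
        unfolding \<phi>_def by (intro borel_measurable_lim_metric measurable_component_singleton) simp
    qed
    fix t assume "t \<in> T"
    from j[OF this] show "AE \<omega> in M. x t \<omega> = \<phi> (\<lambda>i\<in>UNIV. x (d i) \<omega>) t"
      by eventually_elim (simp add: \<phi>_def limI restrict_UNIV)
  qed
  then show ?thesis by blast
qed

text \<open>Taking the limit along the subsequence \<open>r t\<close> serves both clauses of
  \<open>series_architecture\<close>: it agrees with the sum wherever the series converges, and it
  recovers the mean-square limit almost surely.\<close>

lemma kkl_series_network:
  fixes x :: "real \<Rightarrow> 'a \<Rightarrow> real"
  assumes x: "\<And>t. t \<in> {a..b} \<Longrightarrow> x t \<in> L2 M"
    and kkl: "kkl_decomposition a b M (centered M x) \<theta> e"
  shows "\<exists>\<phi>. nn_represents {a..b} M x UNIV \<theta> \<phi> \<and>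
    series_architecture {a..b} (param_law M UNIV \<theta>) (mean_fun M x) e \<phi>"
proof -
  let ?m = "mean_fun M x"
  have cL2: "centered M x t \<in> L2 M" if "t \<in> {a..b}" for t
    unfolding centered_def[abs_def] by (rule L2_diff[OF x[OF that] L2_const])
  have "\<exists>r :: nat \<Rightarrow> nat. strict_mono r \<and>
      (AE \<omega> in M. (\<lambda>n. \<Sum>k<r n. \<theta> k \<omega> * e k t) \<longlonglongrightarrow> centered M x t \<omega>)" if t: "t \<in> {a..b}" for t
  proof (rule L2_tendsto_AE_subseq)
    show "(\<lambda>\<omega>. \<Sum>k<n. \<theta> k \<omega> * e k t) \<in> L2 M" for n
      by (rule kkl_decomposition_tendsto(1)[where y = "centered M x", OF kkl t cL2[OF t]])
    show "(\<lambda>n. sqdist M (\<lambda>\<omega>. \<Sum>k<n. \<theta> k \<omega> * e k t) (centered M x t)) \<longlonglongrightarrow> 0"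
      by (rule kkl_decomposition_tendsto(2)[OF kkl t cL2[OF t]])
  qed (use cL2[OF t] in blast)+
  then have "\<exists>r :: real \<Rightarrow> nat \<Rightarrow> nat. \<forall>t\<in>{a..b}. strict_mono (r t) \<and>
      (AE \<omega> in M. (\<lambda>n. \<Sum>k<r t n. \<theta> k \<omega> * e k t) \<longlonglongrightarrow> centered M x t \<omega>)"
    by (intro bchoice ballI)
  then obtain r :: "real \<Rightarrow> nat \<Rightarrow> nat" where r: "\<And>t. t \<in> {a..b} \<Longrightarrow> strict_mono (r t)"
      "\<And>t. t \<in> {a..b} \<Longrightarrow> AE \<omega> in M. (\<lambda>n. \<Sum>k<r t n. \<theta> k \<omega> * e k t) \<longlonglongrightarrow> centered M x t \<omega>"
    by blast
  define \<phi> where "\<phi> p t = ?m t + lim (\<lambda>n. \<Sum>k<r t n. p k * e k t)" for p :: "nat \<Rightarrow> real" and t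
  have \<theta>: "\<theta> k \<in> borel_measurable M" for k by (rule L2_measurable[OF kkl_decomposition_L2[OF kkl]])
  have comp: "(\<lambda>p. p k) \<in> borel_measurable (\<Pi>\<^sub>M i\<in>(UNIV::nat set). (borel :: real measure))" for k
    by (rule measurable_component_singleton) simp
  have psum: "(\<lambda>p. \<Sum>k<n. p k * e k t) \<in> borel_measurable (\<Pi>\<^sub>M i\<in>(UNIV::nat set). (borel :: real measure))" for n t
    by (intro borel_measurable_sum borel_measurable_times comp borel_measurable_const)
  have \<phi>: "(\<lambda>p. \<phi> p t) \<in> borel_measurable (\<Pi>\<^sub>M i\<in>(UNIV::nat set). (borel :: real measure))" for t
    unfolding \<phi>_def by (intro borel_measurable_add borel_measurable_const borel_measurable_lim_metric psum)
  have AE_\<phi>: "AE \<omega> in M. x t \<omega> = \<phi> (\<lambda>k. \<theta> k \<omega>) t" if "t \<in> {a..b}" for t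
    using r(2)[OF that] by eventually_elim (simp add: \<phi>_def limI centered_def)
  have "nn_represents {a..b} M x UNIV \<theta> \<phi>"
    unfolding nn_represents_def restrict_UNIV
    by (intro conjI ballI \<theta> AE_\<phi> neural_network_param_law[OF prob_space_axioms] \<phi>)
  moreover have "series_architecture {a..b} (param_law M UNIV \<theta>) ?m e \<phi>"
    unfolding series_architecture_def
  proof (intro conjI ballI allI impI)
    fix t p assume t: "t \<in> {a..b}" and "summable (\<lambda>k. p k * e k t)"
    then have "(\<lambda>n. \<Sum>k<n. p k * e k t) \<longlonglongrightarrow> (\<Sum>k. p k * e k t)" by (intro summable_LIMSEQ)
    from LIMSEQ_subseq_LIMSEQ[OF this r(1)[OF t]]
    show "\<phi> p t = ?m t + (\<Sum>k. p k * e k t)" by (simp add: \<phi>_def o_def limI)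
  next
    fix t assume t: "t \<in> {a..b}"
    \<comment> \<open>Change of variables moves the distance from the parameter law to
      \<open>M\<close>, where the network equals \<open>x t\<close> and the mean cancels.\<close>
    have "mean_square_dist (param_law M UNIV \<theta>) (\<lambda>p. ?m t + (\<Sum>k<n. p k * e k t)) (\<lambda>p. \<phi> p t)
        = mean_square_dist M (\<lambda>\<omega>. \<Sum>k<n. \<theta> k \<omega> * e k t) (centered M x t)" for n
    proof -
      have "mean_square_dist (param_law M UNIV \<theta>) (\<lambda>p. ?m t + (\<Sum>k<n. p k * e k t)) (\<lambda>p. \<phi> p t)
        = (\<integral>\<^sup>+\<omega>. ennreal ((?m t + (\<Sum>k<n. \<theta> k \<omega> * e k t) - \<phi> (\<lambda>k. \<theta> k \<omega>) t)\<^sup>2) \<partial>M)"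
        unfolding mean_square_dist_def param_law_def
        by (subst nn_integral_distr[OF measurable_param_restrict])
           (use \<theta> in \<open>auto simp: restrict_UNIV intro!: measurable_compose[OF _ measurable_ennreal] borel_measurable_power
              borel_measurable_diff borel_measurable_add borel_measurable_const psum \<phi>\<close>)
      also have "\<dots> = mean_square_dist M (\<lambda>\<omega>. \<Sum>k<n. \<theta> k \<omega> * e k t) (centered M x t)"
        unfolding mean_square_dist_def
        by (rule nn_integral_cong_AE, use AE_\<phi>[OF t] in eventually_elim)
           (simp add: centered_def algebra_simps)
      finally show ?thesis .
    qed
    then show "(\<lambda>n. mean_square_dist (param_law M UNIV \<theta>)
        (\<lambda>p. ?m t + (\<Sum>k<n. p k * e k t)) (\<lambda>p. \<phi> p t)) \<longlonglongrightarrow> 0"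
      using kkl t unfolding kkl_decomposition_def by simp
  qed
  ultimately show ?thesis by blast
qed

text \<open>Centering does not increase mean-square distances, because the mean is the best
  constant; mean-square continuity is therefore inherited.\<close>

lemma centered_ms_process_centered:
  assumes "a < b" and x: "\<And>t. t \<in> {a..b} \<Longrightarrow> x t \<in> L2 M"
    and ms: "\<And>t. t \<in> {a..b} \<Longrightarrow> ((\<lambda>s. sqdist M (x s) (x t)) \<longlongrightarrow> 0) (at t within {a..b})"
  shows "centered_ms_process M a b (centered M x)"
proof (unfold_locales)
  show cL2: "centered M x t \<in> L2 M" if "t \<in> {a..b}" for t
    unfolding centered_def[abs_def] by (rule L2_diff[OF x[OF that] L2_const])
  show "expectation (centered M x t) = 0" if "t \<in> {a..b}" for t
    unfolding centered_def[abs_def] mean_fun_def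
    using L2_integrable[OF x[OF that]] by (simp add: prob_space)
  have le: "sqdist M (centered M x s) (centered M x t) \<le> sqdist M (x s) (x t)" if "s \<in> {a..b}" "t \<in> {a..b}" for s t
  proof -
    let ?z = "\<lambda>\<omega>. x s \<omega> - x t \<omega>"
    have "expectation ?z = mean_fun M x s - mean_fun M x t"
      using L2_integrable[OF x[OF that(1)]] L2_integrable[OF x[OF that(2)]] by (simp add: mean_fun_def)
    then have "sqdist M (centered M x s) (centered M x t) = sqdist M ?z (\<lambda>_. expectation ?z)"
      by (simp only: sqdist_def centered_def) (simp add: diff_diff_eq add_diff_eq diff_diff_eq2 add.commute)
    also have "\<dots> \<le> sqdist M ?z (\<lambda>_. 0)" by (rule sqdist_expectation_le[OF L2_diff[OF x[OF that(1)] x[OF that(2)]]])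
    finally show ?thesis by (simp add: sqdist_def)
  qed
  fix t assume t: "t \<in> {a..b}"
  show "((\<lambda>s. sqdist M (centered M x s) (centered M x t)) \<longlongrightarrow> 0) (at t within {a..b})"
  proof (rule tendsto_sandwich[OF _ _ tendsto_const ms[OF t]])
    show "\<forall>\<^sub>F s in at t within {a..b}. 0 \<le> sqdist M (centered M x s) (centered M x t)"
      by (simp add: sqdist_nonneg)
    show "\<forall>\<^sub>F s in at t within {a..b}. sqdist M (centered M x s) (centered M x t) \<le> sqdist M (x s) (x t)"
      unfolding eventually_at_filter by (rule always_eventually) (use le t in blast)
  qed
qed (rule assms(1))

end

section \<open>Two-point functions and the path space\<close>

lemma square_integrable_process_L2:
  "square_integrable_process T M x \<Longrightarrow> t \<in> T \<Longrightarrow> x t \<in> L2 M"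
  by (auto simp: square_integrable_process_def L2_def power2_eq_square)

lemma continuous_two_point_imp_ms_continuous:
  assumes sq: "square_integrable_process T M x"
    and cont: "continuous_on (T \<times> T) (\<lambda>(t, s). two_point M x t s)" and t: "t \<in> T"
  shows "((\<lambda>s. sqdist M (x s) (x t)) \<longlongrightarrow> 0) (at t within T)"
proof -
  let ?G = "two_point M x"
  note L = square_integrable_process_L2[OF sq]
  \<comment> \<open>Joint continuity restricted to curves: the diagonal and the section with second
    time \<open>t\<close>.\<close>
  have c: "continuous_on T (\<lambda>s. ?G (f s) (g s))"
    if "continuous_on T f" "continuous_on T g" "f ` T \<subseteq> T" "g ` T \<subseteq> T" for f g
    using continuous_on_compose2[OF cont continuous_on_Pair[OF that(1,2)]] that(3,4) by auto
  have "continuous_on T (\<lambda>s. ?G s s - 2 * ?G s t + ?G t t)"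
    by (intro continuous_intros c) (use t in auto)
  then have "((\<lambda>s. ?G s s - 2 * ?G s t + ?G t t) \<longlongrightarrow> ?G t t - 2 * ?G t t + ?G t t) (at t within T)"
    using t unfolding continuous_on_def by blast
  moreover have "\<forall>\<^sub>F s in at t within T. ?G s s - 2 * ?G s t + ?G t t = sqdist M (x s) (x t)"
    unfolding eventually_at_filter
    by (rule always_eventually) (simp add: sqdist_expand L t two_point_def ip_def)
  ultimately show ?thesis by (simp add: tendsto_cong)
qed

text \<open>Under Kolmogorov's limit measure the coordinates form a process with the prescribed
  laws, which turns \<open>P1\<close> and \<open>P2\<close> into statements about one
  \<open>L2\<close> space.\<close>

lemma MQM_realization:
  assumes P: "P \<in> MQM T"
  obtains M :: "(real \<Rightarrow> real) measure" where "prob_space M"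
    "\<And>t. t \<in> T \<Longrightarrow> (\<lambda>p. p t) \<in> L2 M"
    "\<And>t. t \<in> T \<Longrightarrow> ((\<lambda>s. sqdist M (\<lambda>p. p s) (\<lambda>p. p t)) \<longlongrightarrow> 0) (at t within T)"
    "\<And>J. finite J \<Longrightarrow> J \<subseteq> T \<Longrightarrow> joint_law M (\<lambda>t p. p t) J = P J"
proof -
  have pf: "projective_family T P (\<lambda>_. borel)" and p1: "P1 T P" and p2: "P2 T P"
    using P by (auto simp: MQM_def stochastic_process_def)
  \<comment> \<open>From here on \<open>lim\<close> is the projective limit measure, not the limit
    of a sequence.\<close>
  interpret polish_projective T P by (rule polish_projective.intro[OF pf])
  have coord: "(\<lambda>p. p t) \<in> borel_measurable lim" if "t \<in> T" for t
    using measurable_component_singleton[OF that, of "\<lambda>_. borel :: real measure"]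
    by (simp cong: measurable_cong_sets)
  have restr: "(\<lambda>p. \<lambda>t\<in>J. p t) \<in> lim \<rightarrow>\<^sub>M (\<Pi>\<^sub>M t\<in>J. borel)" if "J \<subseteq> T" for J
    using that coord by (intro measurable_restrict) blast
  have law: "joint_law lim (\<lambda>t p. p t) J = P J" if J: "finite J" "J \<subseteq> T" for J
  proof (rule measure_eqI)
    show "sets (joint_law lim (\<lambda>t p. p t) J) = sets (P J)"
      by (simp add: joint_law_def sets_P J)
    fix X assume "X \<in> sets (joint_law lim (\<lambda>t p. p t) J)"
    then have X: "X \<in> sets (\<Pi>\<^sub>M t\<in>J. borel)" by (simp add: joint_law_def)
    \<comment> \<open>The preimage of \<open>X\<close> under restriction to \<open>J\<close> is the
      cylinder over \<open>X\<close>.\<close>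
    have "emeasure (joint_law lim (\<lambda>t p. p t) J) X = emeasure lim (emb T J X)"
      unfolding joint_law_def emeasure_distr[OF restr[OF J(2)] X]
      by (simp add: prod_emb_def space_PiM)
    then show "emeasure (joint_law lim (\<lambda>t p. p t) J) X = emeasure (P J) X"
      using emeasure_lim_emb[OF J(2,1) X] by simp
  qed
  have L: "(\<lambda>p. p t) \<in> L2 lim" if t: "t \<in> T" for t
  proof -
    \<comment> \<open>The diagonal case of \<open>P2\<close>: \<open>{t, t}\<close> is
      \<open>{t}\<close>, and the product is a second moment.\<close>
    have "integrable (P {t, t}) (\<lambda>p. p t * p t)" using p2 t unfolding P2_def by blast
    then have "integrable (joint_law lim (\<lambda>t p. p t) {t}) (\<lambda>p. p t * p t)" using law[of "{t}"] t by simp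
    then have "integrable lim (\<lambda>p. p t * p t)"
      unfolding joint_law_def by (subst (asm) integrable_distr_eq) (use restr[of "{t}"] t in auto)
    then show ?thesis using coord[OF t] by (simp add: L2_def power2_eq_square)
  qed
  have msd: "mean_square_dist (P {t, s}) (\<lambda>p. p t) (\<lambda>p. p s) = mean_square_dist lim (\<lambda>p. p t) (\<lambda>p. p s)"
    if "t \<in> T" "s \<in> T" for t s
  proof -
    have "mean_square_dist (joint_law lim (\<lambda>t p. p t) {t, s}) (\<lambda>p. p t) (\<lambda>p. p s) = mean_square_dist lim (\<lambda>p. p t) (\<lambda>p. p s)"
      unfolding mean_square_dist_def joint_law_def
      by (subst nn_integral_distr[OF restr]) (use that in auto)
    then show ?thesis using law[of "{t, s}"] that by simp
  qed
  have ms: "((\<lambda>s. sqdist lim (\<lambda>p. p s) (\<lambda>p. p t)) \<longlongrightarrow> 0) (at t within T)" if t: "t \<in> T" for t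
  proof -
    have "((\<lambda>s. mean_square_dist (P {s, t}) (\<lambda>p. p s) (\<lambda>p. p t)) \<longlongrightarrow> 0) (at t within T)"
      using p1 t by (simp add: P1_def)
    moreover have "\<forall>\<^sub>F s in at t within T. mean_square_dist (P {s, t}) (\<lambda>p. p s) (\<lambda>p. p t) =
        mean_square_dist lim (\<lambda>p. p s) (\<lambda>p. p t)"
      unfolding eventually_at_filter by (rule always_eventually) (use msd t in blast)
    ultimately have "((\<lambda>s. mean_square_dist lim (\<lambda>p. p s) (\<lambda>p. p t)) \<longlongrightarrow> 0) (at t within T)"
      by (simp add: tendsto_cong)
    moreover have "\<forall>\<^sub>F s in at t within T. (\<lambda>p. p s - p t) \<in> L2 lim"
      unfolding eventually_at_filter by (rule always_eventually) (use L2_diff[OF L L] t in blast)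
    ultimately show ?thesis by (subst (asm) mean_square_dist_tendsto_iff)
  qed
  show ?thesis by (rule that[OF P.prob_space_axioms L ms law])
qed

lemma MQM_subset_NNQM:
  assumes "T \<noteq> {}" and inf: "infinite (UNIV :: 'i set)"
  shows "MQM T \<subseteq> NNQM TYPE('i) T"
proof
  fix P assume P: "P \<in> MQM T"
  obtain M where M: "prob_space M" and L: "\<And>t. t \<in> T \<Longrightarrow> (\<lambda>p. p t) \<in> L2 M"
    and ms: "\<And>t. t \<in> T \<Longrightarrow> ((\<lambda>s. sqdist M (\<lambda>p. p s) (\<lambda>p. p t)) \<longlongrightarrow> 0) (at t within T)"
    and law: "\<And>J. finite J \<Longrightarrow> J \<subseteq> T \<Longrightarrow> joint_law M (\<lambda>t p. p t) J = P J"
    using MQM_realization[OF P] by blast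
  obtain \<theta> :: "nat \<Rightarrow> (real \<Rightarrow> real) \<Rightarrow> real" and \<phi> where rep: "nn_represents T M (\<lambda>t p. p t) UNIV \<theta> \<phi>"
    using prob_space.nn_represents_dense_samples[OF M assms(1) L ms] by blast
  obtain g :: "nat \<Rightarrow> 'i" where g: "inj g" using infinite_countable_subset[OF inf] by blast
  note rep' = nn_represents_reindex[OF M rep g]
  have "admits_nn TYPE('i) T P"
    unfolding admits_nn_def
  proof (intro exI conjI allI impI)
    show "neural_network T (range g) (param_law M (range g) (\<lambda>i. \<theta> (inv g i))) (\<lambda>p. \<phi> (\<lambda>k. p (g k)))"
      using rep' by (simp add: nn_represents_def)
    fix J assume "finite J \<and> J \<subseteq> T"
    then show "P J = joint_law (param_law M (range g) (\<lambda>i. \<theta> (inv g i))) (\<lambda>t p. \<phi> (\<lambda>k. p (g k)) t) J"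
      using nn_represents_joint_law[OF L2_measurable[OF L] rep', of J] law[of J] by simp
  qed
  then show "P \<in> NNQM TYPE('i) T" using P by (simp add: MQM_def NNQM_def)
qed

text \<open>On all of \<open>T\<close>, possibly the whole line, the network reads samples of the
  process; the series network lives on compact subintervals. The closing equivalence about active
  parameters makes "generically infinite" precise, for every decomposition and not only the
  constructed one.\<close>

theorem mainTheorem1:
  fixes T :: "real set"
  assumes "T = UNIV \<or> (\<exists>c d. c < d \<and> T = {c..d})"
    and "infinite (UNIV :: 'i set)"
  shows "(\<forall>(M :: 'w measure) x.
            square_integrable_process T M x \<and>
            continuous_on (T \<times> T) (\<lambda>(t, s). two_point M x t s) \<longrightarrow>
              (\<exists>(\<theta> :: nat \<Rightarrow> 'w \<Rightarrow> real) \<phi>. nn_represents T M x UNIV \<theta> \<phi>) \<and>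
              (\<forall>a b. a < b \<and> {a..b} \<subseteq> T \<longrightarrow>
                 (\<exists>\<theta> e. kkl_decomposition a b M (centered M x) \<theta> e) \<and>
                 (\<forall>\<theta> e. kkl_decomposition a b M (centered M x) \<theta> e \<longrightarrow>
                    (\<exists>\<phi>. nn_represents {a..b} M x UNIV \<theta> \<phi> \<and>
                          series_architecture {a..b} (param_law M UNIV \<theta>) (mean_fun M x) e \<phi>) \<and>
                    (infinite (active_params {a..b} M \<theta> e) \<longleftrightarrow>
                       \<not> finite_rank_process {a..b} M (centered M x)))))
       \<and> MQM T \<subseteq> NNQM TYPE('i) T
       \<and> NNQM TYPE('i) T = MQM T"
proof -
  have ne: "T \<noteq> {}" using assms(1) by auto
  have sub: "MQM T \<subseteq> NNQM TYPE('i) T" by (rule MQM_subset_NNQM[OF ne assms(2)])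
  \<comment> \<open>By definition: an NN-QM is an MQM with one further property.\<close>
  moreover have "NNQM TYPE('i) T \<subseteq> MQM T" by (auto simp: NNQM_def MQM_def)
  moreover have "(\<exists>(\<theta> :: nat \<Rightarrow> 'w \<Rightarrow> real) \<phi>. nn_represents T M x UNIV \<theta> \<phi>) \<and>
      (\<forall>a b. a < b \<and> {a..b} \<subseteq> T \<longrightarrow>
         (\<exists>\<theta> e. kkl_decomposition a b M (centered M x) \<theta> e) \<and>
         (\<forall>\<theta> e. kkl_decomposition a b M (centered M x) \<theta> e \<longrightarrow>
            (\<exists>\<phi>. nn_represents {a..b} M x UNIV \<theta> \<phi> \<and>
                  series_architecture {a..b} (param_law M UNIV \<theta>) (mean_fun M x) e \<phi>) \<and>
            (infinite (active_params {a..b} M \<theta> e) \<longleftrightarrow>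
               \<not> finite_rank_process {a..b} M (centered M x))))"
    if sq: "square_integrable_process T M x"
      and cont: "continuous_on (T \<times> T) (\<lambda>(t, s). two_point M x t s)" for M :: "'w measure" and x
  proof -
    interpret prob_space M using sq by (simp add: square_integrable_process_def)
    note L = square_integrable_process_L2[OF sq]
    note ms = continuous_two_point_imp_ms_continuous[OF sq cont]
    show ?thesis
    proof (intro conjI allI impI)
      show "\<exists>(\<theta> :: nat \<Rightarrow> 'w \<Rightarrow> real) \<phi>. nn_represents T M x UNIV \<theta> \<phi>"
        by (rule nn_represents_dense_samples[OF ne L ms])
    next
      fix a b assume ab: "a < b \<and> {a..b} \<subseteq> T"
      have Lab: "x t \<in> L2 M" if "t \<in> {a..b}" for t using ab that by (intro L) blast
      have msab: "((\<lambda>s. sqdist M (x s) (x t)) \<longlongrightarrow> 0) (at t within {a..b})" if "t \<in> {a..b}" for t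
        using tendsto_within_subset[OF ms] ab that by blast
      interpret c: centered_ms_process M a b "centered M x"
        by (rule centered_ms_process_centered[OF _ Lab msab]) (use ab in auto)
      show "\<exists>\<theta> e. kkl_decomposition a b M (centered M x) \<theta> e" by (rule c.kkl_decomposition_exists)
      fix \<theta> e assume kkl: "kkl_decomposition a b M (centered M x) \<theta> e"
      show "\<exists>\<phi>. nn_represents {a..b} M x UNIV \<theta> \<phi> \<and>
          series_architecture {a..b} (param_law M UNIV \<theta>) (mean_fun M x) e \<phi>"
        by (rule kkl_series_network[OF Lab kkl])
      show "infinite (active_params {a..b} M \<theta> e) \<longleftrightarrow> \<not> finite_rank_process {a..b} M (centered M x)"
        using finite_active_params_imp_finite_rank[OF kkl c.yL2]
          finite_rank_imp_finite_active_params[OF c.ab kkl c.yL2] by blast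
    qed
  qed
  ultimately show ?thesis by blast
qed

end
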